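(* Let $f$ be a (orientation-preserving) $C^{1+bv}$ diffeomorphism of a compact one-dimensional manifold $M$. Then the asymptotic distortion $\mathrm{dist}_\infty(f)$ vanishes if and only if there exists a sequence $(h_n)$ of $C^{1+bv}$ diffeomorphisms of $M$ such that the conjugates $h_n f h_n^{-1}$ converge to an isometry in the $C^{1+bv}$ sense.
   Context: All diffeomorphisms are orientation preserving. $M$ is the circle $\mathrm{S}^1=\mathbb{R}/\mathbb{Z}$ or a compact interval; an (orientation-preserving) isometry is thus a rotation when $M$ is the circle and the identity when $M$ is an interval. A $C^{1+bv}$ diffeomorphism is a $C^1$ diffeomorphism $f$ such that $\log(Df)$ has finite total variation; $\mathrm{var}$ denotes total variation on $M$. The asymptotic distortion of a $C^{1+bv}$ diffeomorphism $f$ is $$\mathrm{dist}_\infty(f):=\lim_{n\to\infty}\frac{\mathrm{var}(\log(Df^n))}{n},$$ where $f^n$ is the $n$-th iterate; the limit exists by subadditivity. Diffeomorphisms $F_n$ converge to an isometry $R$ in the $C^{1+bv}$ sense if $F_n\to R$ uniformly, $DF_n\to 1$ uniformly, and $\mathrm{var}(\log(DF_n))\to 0$. *)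

theory Defs
  imports "HOL-Analysis.Analysis"
begin

section \<open>Total variation on a compact interval\<close>

definition variation_sums :: "real \<Rightarrow> real \<Rightarrow> (real \<Rightarrow> real) \<Rightarrow> real set" where
  "variation_sums a b \<phi> =
     {\<Sum>i<n. \<bar>\<phi> (t (Suc i)) - \<phi> (t i)\<bar> | (n::nat) t.
        mono_on {..n} t \<and> t ` {..n} \<subseteq> {a..b}}"

definition bounded_variation :: "real \<Rightarrow> real \<Rightarrow> (real \<Rightarrow> real) \<Rightarrow> bool" where
  "bounded_variation a b \<phi> \<longleftrightarrow> bdd_above (variation_sums a b \<phi>)"

text \<open>This is a real number, hence only meaningful under \<^const>\<open>bounded_variation\<close>.\<close>

definition total_variation :: "real \<Rightarrow> real \<Rightarrow> (real \<Rightarrow> real) \<Rightarrow> real" where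
  "total_variation a b \<phi> = Sup (variation_sums a b \<phi>)"


section \<open>Diffeomorphisms of a compact interval\<close>

text \<open>
  A self-map of the interval from \<open>a\<close> to \<open>b\<close> is a function on the reals of which only the
  values on \<open>{a..b}\<close> matter; derivatives at the two endpoints are one-sided.
\<close>

definition ivl_deriv :: "real \<Rightarrow> real \<Rightarrow> (real \<Rightarrow> real) \<Rightarrow> real \<Rightarrow> real" where
  "ivl_deriv a b f x = vector_derivative f (at x within {a..b})"

text \<open>
  A \<open>C\<^sup>1\<close> bijection with positive derivative has a \<open>C\<^sup>1\<close> inverse, so regularity of the inverse
  is not listed separately here, nor for the circle below.
\<close>

definition ivl_C1_diffeo :: "real \<Rightarrow> real \<Rightarrow> (real \<Rightarrow> real) \<Rightarrow> bool" where
  "ivl_C1_diffeo a b f \<longleftrightarrow>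
     bij_betw f {a..b} {a..b} \<and>
     (\<forall>x\<in>{a..b}. f differentiable (at x within {a..b}) \<and> ivl_deriv a b f x > 0) \<and>
     continuous_on {a..b} (ivl_deriv a b f)"

definition ivl_C1bv_diffeo :: "real \<Rightarrow> real \<Rightarrow> (real \<Rightarrow> real) \<Rightarrow> bool" where
  "ivl_C1bv_diffeo a b f \<longleftrightarrow>
     ivl_C1_diffeo a b f \<and> bounded_variation a b (\<lambda>x. ln (ivl_deriv a b f x))"

definition ivl_asymptotic_distortion :: "real \<Rightarrow> real \<Rightarrow> (real \<Rightarrow> real) \<Rightarrow> real" where
  "ivl_asymptotic_distortion a b f =
     lim (\<lambda>n. total_variation a b (\<lambda>x. ln (ivl_deriv a b (f ^^ n) x)) / real n)"

definition ivl_isometry :: "real \<Rightarrow> real \<Rightarrow> (real \<Rightarrow> real) \<Rightarrow> bool" where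
  "ivl_isometry a b R \<longleftrightarrow>
     ivl_C1_diffeo a b R \<and> (\<forall>x\<in>{a..b}. \<forall>y\<in>{a..b}. dist (R x) (R y) = dist x y)"

definition ivl_C1bv_converges ::
    "real \<Rightarrow> real \<Rightarrow> (nat \<Rightarrow> real \<Rightarrow> real) \<Rightarrow> (real \<Rightarrow> real) \<Rightarrow> bool" where
  "ivl_C1bv_converges a b F R \<longleftrightarrow>
     uniform_limit {a..b} F R sequentially \<and>
     uniform_limit {a..b} (\<lambda>n. ivl_deriv a b (F n)) (\<lambda>_. 1) sequentially \<and>
     (\<lambda>n. total_variation a b (\<lambda>x. ln (ivl_deriv a b (F n) x))) \<longlonglongrightarrow> 0"


section \<open>The circle \<open>\<real>/\<int>\<close>\<close>

quotient_type circle = real / "\<lambda>x y. x - y \<in> \<int>"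
proof (rule equivpI)
  show "reflp (\<lambda>x y::real. x - y \<in> \<int>)"
    by (auto intro: reflpI)
  show "symp (\<lambda>x y::real. x - y \<in> \<int>)"
    by (rule sympI) (metis Ints_minus minus_diff_eq)
  show "transp (\<lambda>x y::real. x - y \<in> \<int>)"
  proof (rule transpI)
    fix x y z :: real
    assume "x - y \<in> \<int>" "y - z \<in> \<int>"
    then have "(x - y) + (y - z) \<in> \<int>" by (rule Ints_add)
    then show "x - z \<in> \<int>" by simp
  qed
qed

lift_definition to_circle :: "real \<Rightarrow> circle" is "\<lambda>x. x" .

definition dist_to_int :: "real \<Rightarrow> real" where
  "dist_to_int u = \<bar>u - of_int (round u)\<bar>"

lemma dist_to_int_le: "dist_to_int u \<le> \<bar>u - of_int m\<bar>"
  unfolding dist_to_int_def by (rule round_diff_minimal)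

lemma dist_to_int_le_shift:
  assumes "u - v \<in> \<int>" shows "dist_to_int u \<le> dist_to_int v"
proof -
  obtain k where "u - v = of_int k" using assms by (rule Ints_cases)
  then have "u - of_int (k + round v) = v - of_int (round v)" by simp
  then show ?thesis
    using dist_to_int_le[of u "k + round v"] by (simp only: dist_to_int_def[of v])
qed

lemma dist_to_int_cong: "u - v \<in> \<int> \<Longrightarrow> dist_to_int u = dist_to_int v"
  using dist_to_int_le_shift[of u v] dist_to_int_le_shift[of v u]
  by (metis Ints_minus minus_diff_eq order_antisym)

lemma dist_to_int_eq_0_iff: "dist_to_int u = 0 \<longleftrightarrow> u \<in> \<int>"
proof
  assume "dist_to_int u = 0"
  then have "u = of_int (round u)" by (simp add: dist_to_int_def)
  then show "u \<in> \<int>" by (metis Ints_of_int)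
next
  assume "u \<in> \<int>"
  then show "dist_to_int u = 0" by (auto simp: dist_to_int_def elim: Ints_cases)
qed

lemma dist_to_int_minus: "dist_to_int (- u) = dist_to_int u"
proof -
  have le: "dist_to_int (- v) \<le> dist_to_int v" for v
    using dist_to_int_le[of "- v" "- round v"] by (simp add: dist_to_int_def)
  show ?thesis using le[of u] le[of "- u"] by simp
qed

lemma dist_to_int_add_le: "dist_to_int (u + v) \<le> dist_to_int u + dist_to_int v"
  using dist_to_int_le[of "u + v" "round u + round v"] by (simp add: dist_to_int_def)

instantiation circle :: metric_space
begin

lift_definition dist_circle :: "circle \<Rightarrow> circle \<Rightarrow> real" is "\<lambda>x y. dist_to_int (x - y)"
proof -
  fix x x' y y' :: real
  assume "x - x' \<in> \<int>" "y - y' \<in> \<int>"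
  then have "(x - x') - (y - y') \<in> \<int>" by (rule Ints_diff)
  then show "dist_to_int (x - y) = dist_to_int (x' - y')"
    by (intro dist_to_int_cong) (simp add: algebra_simps)
qed

definition uniformity_circle :: "(circle \<times> circle) filter" where
  "uniformity_circle = (INF e\<in>{0 <..}. principal {(x, y). dist x y < e})"

definition open_circle :: "circle set \<Rightarrow> bool" where
  "open_circle U \<longleftrightarrow> (\<forall>x\<in>U. eventually (\<lambda>(x', y). x' = x \<longrightarrow> y \<in> U) uniformity)"

instance
proof
  fix x y z :: circle
  show "dist x y = 0 \<longleftrightarrow> x = y"
    by transfer (rule dist_to_int_eq_0_iff)
  show "dist x y \<le> dist x z + dist y z"
  proof transfer
    fix x y z :: real
    show "dist_to_int (x - y) \<le> dist_to_int (x - z) + dist_to_int (y - z)"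
      using dist_to_int_add_le[of "x - z" "z - y"] dist_to_int_minus[of "y - z"] by simp
  qed
qed (simp_all add: uniformity_circle_def open_circle_def)

end


section \<open>Diffeomorphisms of the circle\<close>

definition circle_lift :: "(circle \<Rightarrow> circle) \<Rightarrow> (real \<Rightarrow> real) \<Rightarrow> bool" where
  "circle_lift f F \<longleftrightarrow>
     continuous_on UNIV F \<and> (\<forall>x. to_circle (F x) = f (to_circle x))"

definition circle_deriv :: "(circle \<Rightarrow> circle) \<Rightarrow> circle \<Rightarrow> real" where
  "circle_deriv f z =
     (THE d. \<exists>F x. circle_lift f F \<and> to_circle x = z \<and> (F has_real_derivative d) (at x))"

text \<open>The description is definite: the derivative of a lift depends neither on the lift nor on
  the representative of the base point.\<close>

lemma to_circle_eq_iff: "to_circle x = to_circle y \<longleftrightarrow> x - y \<in> \<int>"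
  by transfer simp

lemma circle_lift_has_deriv_unique:
  assumes F: "circle_lift f F" "(F has_real_derivative d) (at x)"
    and G: "circle_lift f G" "(G has_real_derivative e) (at y)"
    and xy: "to_circle x = to_circle y"
  shows "d = e"
proof -
  define c where "c = y - x"
  have c: "c \<in> \<int>" using xy unfolding c_def by (metis to_circle_eq_iff)
  have eq: "to_circle (u + c) = to_circle u" for u
    using c by (simp add: to_circle_eq_iff)
  define H where "H u = G (u + c) - F u" for u
  have Ints: "H u \<in> \<int>" for u
  proof -
    have "to_circle (G (u + c)) = to_circle (F u)"
      using F(1) G(1) eq[of u] unfolding circle_lift_def by simp
    then show ?thesis unfolding H_def by (simp only: to_circle_eq_iff)
  qed
  have "continuous_on UNIV G" "continuous_on UNIV F"
    using F(1) G(1) unfolding circle_lift_def by simp_all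
  moreover have "continuous_on UNIV (\<lambda>u::real. u + c)"
    by (intro continuous_on_add continuous_on_id continuous_on_const)
  ultimately have cont: "continuous_on UNIV H"
    unfolding H_def
    by (intro continuous_on_diff continuous_on_compose2[of UNIV G UNIV "\<lambda>u. u + c"]) simp_all
  have "H constant_on UNIV"
  proof (rule continuous_discrete_range_constant[OF connected_UNIV cont])
    fix u :: real
    have "1 \<le> norm (H v - H u)" if "H v \<noteq> H u" for v
      using Ints_nonzero_abs_ge1[OF Ints_diff[OF Ints[of v] Ints[of u]]] that by simp
    then show "\<exists>e>0. \<forall>v. v \<in> UNIV \<and> H v \<noteq> H u \<longrightarrow> e \<le> norm (H v - H u)"
      by (intro exI[of _ 1]) auto
  qed
  then obtain k where k: "\<And>u. H u = k" unfolding constant_on_def by auto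
  have "F = (\<lambda>u. G (u + c) - k)"
    using k unfolding H_def by (simp add: fun_eq_iff algebra_simps)
  moreover have "((\<lambda>u. G (u + c) - k) has_real_derivative e) (at x)"
  proof -
    have "(G has_real_derivative e) (at (x + c))" using G(2) by (simp add: c_def)
    then have "((\<lambda>u. G (u + c)) has_real_derivative e) (at x)" by (simp only: DERIV_shift)
    then show ?thesis by (auto intro!: derivative_eq_intros)
  qed
  ultimately show ?thesis using F(2) DERIV_unique by blast
qed

lemma circle_deriv_lift:
  assumes "circle_lift f F" "(F has_real_derivative d) (at x)"
  shows "circle_deriv f (to_circle x) = d"
  unfolding circle_deriv_def
  using assms by (intro the_equality) (auto dest: circle_lift_has_deriv_unique)

definition circle_C1_diffeo :: "(circle \<Rightarrow> circle) \<Rightarrow> bool" where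
  "circle_C1_diffeo f \<longleftrightarrow>
     bij f \<and>
     (\<exists>F. circle_lift f F \<and> (\<forall>x. F differentiable (at x) \<and> deriv F x > 0) \<and>
          continuous_on UNIV (deriv F))"

text \<open>
  The variation of \<open>\<phi>\<close> on the circle is the supremum of its variation over cyclically ordered
  tuples of points. Adding the base point to such a tuple does not decrease the sum, so this is
  the variation of \<open>\<phi> \<circ> to_circle\<close> over one period.
\<close>

definition circle_bounded_variation :: "(circle \<Rightarrow> real) \<Rightarrow> bool" where
  "circle_bounded_variation \<phi> \<longleftrightarrow> bounded_variation 0 1 (\<phi> \<circ> to_circle)"

definition circle_total_variation :: "(circle \<Rightarrow> real) \<Rightarrow> real" where
  "circle_total_variation \<phi> = total_variation 0 1 (\<phi> \<circ> to_circle)"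

definition circle_C1bv_diffeo :: "(circle \<Rightarrow> circle) \<Rightarrow> bool" where
  "circle_C1bv_diffeo f \<longleftrightarrow>
     circle_C1_diffeo f \<and> circle_bounded_variation (\<lambda>z. ln (circle_deriv f z))"

definition circle_asymptotic_distortion :: "(circle \<Rightarrow> circle) \<Rightarrow> real" where
  "circle_asymptotic_distortion f =
     lim (\<lambda>n. circle_total_variation (\<lambda>z. ln (circle_deriv (f ^^ n) z)) / real n)"

definition circle_isometry :: "(circle \<Rightarrow> circle) \<Rightarrow> bool" where
  "circle_isometry R \<longleftrightarrow> circle_C1_diffeo R \<and> (\<forall>x y. dist (R x) (R y) = dist x y)"

definition circle_C1bv_converges ::
    "(nat \<Rightarrow> circle \<Rightarrow> circle) \<Rightarrow> (circle \<Rightarrow> circle) \<Rightarrow> bool" where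
  "circle_C1bv_converges F R \<longleftrightarrow>
     uniform_limit UNIV F R sequentially \<and>
     uniform_limit UNIV (\<lambda>n. circle_deriv (F n)) (\<lambda>_. 1) sequentially \<and>
     (\<lambda>n. circle_total_variation (\<lambda>z. ln (circle_deriv (F n) z))) \<longlonglongrightarrow> 0"

end

theory Submission
  imports Defs
begin

text \<open>
  Let \<open>h\<^sub>n\<close> be the diffeomorphism whose derivative is, up to a constant factor, the geometric mean of
  \<open>D(f\<^sup>i)\<close> for \<open>i < n\<close>. By the chain rule the logarithmic derivative of the conjugate
  \<open>g\<^sub>n = h\<^sub>n f h\<^sub>n\<^sup>-\<^sup>1\<close> telescopes to \<open>log D(f\<^sup>n) / n\<close> composed with \<open>h\<^sub>n\<^sup>-\<^sup>1\<close>, so its variation tends to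
  \<open>0\<close> if the asymptotic distortion vanishes. As \<open>Dg\<^sub>n\<close> has mean \<open>1\<close>, it equals \<open>1\<close> somewhere, and hence
  tends to \<open>1\<close> uniformly. On the interval \<open>g\<^sub>n\<close> then tends to the identity; on the circle a
  subsequence for which \<open>g\<^sub>n(0)\<close> converges tends to a rotation. Conversely,
  \<open>var (log D(f\<^sup>k)) \<le> k var (log Dg) + 2 var (log Dh)\<close> for every conjugate \<open>g = h f h\<^sup>-\<^sup>1\<close>.
\<close>

section \<open>Total variation\<close>

text \<open>Conjugating by \<open>h\<close> alters \<open>log Df\<close> by the coboundary of
  \<open>log Dh\<close>, so the task is to solve \<open>log Df = u - u \<circ> f\<close> up to an
  error of small variation. Since \<open>log D(f^i)\<close> is the \<open>i\<close>-th Birkhoff sum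
  of \<open>log Df\<close>, the average of these sums is the standard approximate solution. To be
  \<open>log Dh\<close> of a diffeomorphism, \<open>u\<close> must be normalised so that
  \<open>exp u\<close> has the right integral; this adds a constant, which cancels in the coboundary
  and is invisible to the variation. The variation does not grow under an increasing change of
  variable, so the estimate for the conjugate holds however wild the conjugacies become. In the
  converse the term \<open>2 var (log Dh)\<close> has no bound uniform in \<open>h\<close>; it
  disappears because \<open>k\<close> tends to infinity while \<open>h\<close> is fixed.
  \<open>Sup\<close> and \<open>lim\<close> return some real number even where the supremum or limit
  fails to exist. Boundedness is therefore carried along with every estimate, and convergence is
  proved before the limit is used.\<close>

lemma variation_sum_le:
  assumes "bounded_variation a b \<phi>" "mono_on {..n} t" "t ` {..n} \<subseteq> {a..b}"
  shows "(\<Sum>i<n. \<bar>\<phi> (t (Suc i)) - \<phi> (t i)\<bar>) \<le> total_variation a b \<phi>"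
  unfolding total_variation_def
  by (rule cSup_upper) (use assms in \<open>auto simp: variation_sums_def bounded_variation_def\<close>)

text \<open>Boundedness and the estimate are drawn together from the same family of sums, because a
  bound on \<open>Sup\<close> says nothing without boundedness. The one-point partition shows that
  the set of sums is nonempty.\<close>

lemma variation_leI:
  assumes "a \<le> b"
    and B: "\<And>n t. mono_on {..n} t \<Longrightarrow> t ` {..n} \<subseteq> {a..b} \<Longrightarrow>
      (\<Sum>i<n. \<bar>\<phi> (t (Suc i)) - \<phi> (t i)\<bar>) \<le> B"
  shows "bounded_variation a b \<phi> \<and> total_variation a b \<phi> \<le> B"
proof -
  have le: "s \<le> B" if "s \<in> variation_sums a b \<phi>" for s
    using that B unfolding variation_sums_def by blast
  have "(\<Sum>i<0. \<bar>\<phi> ((\<lambda>_. a) (Suc i)) - \<phi> ((\<lambda>_. a) i)\<bar>) \<in> variation_sums a b \<phi>"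
    unfolding variation_sums_def using \<open>a \<le> b\<close>
    by (intro CollectI exI[of _ "0::nat"] exI[of _ "\<lambda>_. a"] conjI) (auto simp: mono_on_def)
  then have "variation_sums a b \<phi> \<noteq> {}" by blast
  then show ?thesis
    unfolding bounded_variation_def total_variation_def
    using le by (metis bdd_aboveI cSup_least)
qed

lemma total_variation_nonneg:
  assumes "a \<le> b" "bounded_variation a b \<phi>"
  shows "0 \<le> total_variation a b \<phi>"
  using variation_sum_le[OF assms(2), of 0 "\<lambda>_. a"] assms(1) by (auto simp: mono_on_def)

lemma diff_le_total_variation:
  assumes bv: "bounded_variation a b \<phi>" and "x \<in> {a..b}" "y \<in> {a..b}"
  shows "\<bar>\<phi> x - \<phi> y\<bar> \<le> total_variation a b \<phi>"
proof -
  have le: "\<bar>\<phi> v - \<phi> u\<bar> \<le> total_variation a b \<phi>" if "u \<in> {a..b}" "v \<in> {a..b}" "u \<le> v" for u v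
    using variation_sum_le[OF bv, of 1 "\<lambda>i. if i = 0 then u else v"] that
    by (auto simp: mono_on_def image_subset_iff)
  show ?thesis
    using le[of x y] le[of y x] assms(2,3) by (cases "x \<le> y") (auto simp: abs_minus_commute)
qed

lemma total_variation_add:
  assumes "a \<le> b" "bounded_variation a b \<phi>" "bounded_variation a b \<psi>"
  shows "bounded_variation a b (\<lambda>x. \<phi> x + \<psi> x) \<and>
    total_variation a b (\<lambda>x. \<phi> x + \<psi> x) \<le> total_variation a b \<phi> + total_variation a b \<psi>"
proof (rule variation_leI[OF \<open>a \<le> b\<close>])
  fix n and t :: "nat \<Rightarrow> real" assume t: "mono_on {..n} t" "t ` {..n} \<subseteq> {a..b}"
  have "(\<Sum>i<n. \<bar>\<phi> (t (Suc i)) + \<psi> (t (Suc i)) - (\<phi> (t i) + \<psi> (t i))\<bar>)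
      \<le> (\<Sum>i<n. \<bar>\<phi> (t (Suc i)) - \<phi> (t i)\<bar>) + (\<Sum>i<n. \<bar>\<psi> (t (Suc i)) - \<psi> (t i)\<bar>)"
    unfolding sum.distrib[symmetric] by (rule sum_mono) linarith
  also have "\<dots> \<le> total_variation a b \<phi> + total_variation a b \<psi>"
    using variation_sum_le[OF assms(2) t] variation_sum_le[OF assms(3) t] by linarith
  finally show "(\<Sum>i<n. \<bar>\<phi> (t (Suc i)) + \<psi> (t (Suc i)) - (\<phi> (t i) + \<psi> (t i))\<bar>) \<le>
      total_variation a b \<phi> + total_variation a b \<psi>" .
qed

lemma total_variation_scale:
  assumes "a \<le> b" "bounded_variation a b \<phi>"
  shows "bounded_variation a b (\<lambda>x. c * \<phi> x) \<and>
    total_variation a b (\<lambda>x. c * \<phi> x) \<le> \<bar>c\<bar> * total_variation a b \<phi>"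
proof (rule variation_leI[OF \<open>a \<le> b\<close>])
  fix n and t :: "nat \<Rightarrow> real" assume t: "mono_on {..n} t" "t ` {..n} \<subseteq> {a..b}"
  have "(\<Sum>i<n. \<bar>c * \<phi> (t (Suc i)) - c * \<phi> (t i)\<bar>) = \<bar>c\<bar> * (\<Sum>i<n. \<bar>\<phi> (t (Suc i)) - \<phi> (t i)\<bar>)"
    by (simp add: sum_distrib_left abs_mult[symmetric] right_diff_distrib)
  then show "(\<Sum>i<n. \<bar>c * \<phi> (t (Suc i)) - c * \<phi> (t i)\<bar>) \<le> \<bar>c\<bar> * total_variation a b \<phi>"
    using variation_sum_le[OF assms(2) t] by (simp add: mult_left_mono)
qed

lemma total_variation_const:
  assumes "a \<le> b"
  shows "bounded_variation a b (\<lambda>x. c) \<and> total_variation a b (\<lambda>x. c) = 0"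
proof -
  have "bounded_variation a b (\<lambda>x. c) \<and> total_variation a b (\<lambda>x. c) \<le> 0"
    by (rule variation_leI[OF assms]) simp
  then show ?thesis using total_variation_nonneg[OF assms] by (meson order_antisym)
qed

text \<open>A monotone map carries partitions to partitions, possibly with repeated points, which
  weakly increasing tuples allow. With \<open>g\<close> the identity this also covers congruence and
  restriction to subintervals; with \<open>g\<close> a translation it covers shifts.\<close>

lemma total_variation_comp:
  assumes "a \<le> b" and g: "mono_on {a..b} g" "g ` {a..b} \<subseteq> {c..d}"
    and bv: "bounded_variation c d \<phi>" and \<psi>: "\<And>x. x \<in> {a..b} \<Longrightarrow> \<psi> x = \<phi> (g x)"
  shows "bounded_variation a b \<psi> \<and> total_variation a b \<psi> \<le> total_variation c d \<phi>"
proof (rule variation_leI[OF \<open>a \<le> b\<close>])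
  fix n and t :: "nat \<Rightarrow> real" assume t: "mono_on {..n} t" "t ` {..n} \<subseteq> {a..b}"
  have "mono_on {..n} (g \<circ> t)" "(g \<circ> t) ` {..n} \<subseteq> {c..d}"
    using t g unfolding mono_on_def image_subset_iff by simp_all
  from variation_sum_le[OF bv this]
  have "(\<Sum>i<n. \<bar>\<phi> (g (t (Suc i))) - \<phi> (g (t i))\<bar>) \<le> total_variation c d \<phi>" by simp
  moreover have "(\<Sum>i<n. \<bar>\<psi> (t (Suc i)) - \<psi> (t i)\<bar>) = (\<Sum>i<n. \<bar>\<phi> (g (t (Suc i))) - \<phi> (g (t i))\<bar>)"
    using t(2) \<psi> by (intro sum.cong) (auto simp: image_subset_iff)
  ultimately show "(\<Sum>i<n. \<bar>\<psi> (t (Suc i)) - \<psi> (t i)\<bar>) \<le> total_variation c d \<phi>" by simp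
qed

lemma total_variation_cong:
  assumes "a \<le> b" "bounded_variation a b \<phi>" "\<And>x. x \<in> {a..b} \<Longrightarrow> \<psi> x = \<phi> x"
  shows "bounded_variation a b \<psi> \<and> total_variation a b \<psi> = total_variation a b \<phi>"
proof -
  have "bounded_variation a b \<psi> \<and> total_variation a b \<psi> \<le> total_variation a b \<phi>"
    using assms by (intro total_variation_comp[where g = "\<lambda>x. x"]) (auto simp: mono_on_def)
  moreover from this have "total_variation a b \<phi> \<le> total_variation a b \<psi>"
    using assms total_variation_comp[of a b "\<lambda>x. x" a b \<psi> \<phi>] by (auto simp: mono_on_def)
  ultimately show ?thesis by linarith
qed

lemma bounded_variation_subset:
  assumes "bounded_variation a b \<phi>" "a \<le> c" "c \<le> d" "d \<le> b"
  shows "bounded_variation c d \<phi>"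
  using assms total_variation_comp[of c d "\<lambda>x. x" a b \<phi> \<phi>] by (auto simp: mono_on_def)

section \<open>Splitting an interval and shifting a period\<close>

lemma total_variation_combine_le:
  assumes "a \<le> b" "b \<le> c" "bounded_variation a b \<phi>" "bounded_variation b c \<phi>"
  shows "bounded_variation a c \<phi> \<and>
    total_variation a c \<phi> \<le> total_variation a b \<phi> + total_variation b c \<phi>"
proof (rule variation_leI)
  show "a \<le> c" using assms by simp
  fix n and t :: "nat \<Rightarrow> real" assume t: "mono_on {..n} t" "t ` {..n} \<subseteq> {a..c}"
  \<comment> \<open>Truncating the partition at \<open>b\<close> from above and from below amounts to inserting \<open>b\<close> into it.\<close>
  define u v where "u i = min (t i) b" and "v i = max (t i) b" for i
  have u: "mono_on {..n} u" "u ` {..n} \<subseteq> {a..b}" and v: "mono_on {..n} v" "v ` {..n} \<subseteq> {b..c}"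
    using t assms(1,2) unfolding mono_on_def u_def v_def min_def max_def
    by (auto simp: image_subset_iff) (meson order_trans linear)+
  have "(\<Sum>i<n. \<bar>\<phi> (t (Suc i)) - \<phi> (t i)\<bar>)
      \<le> (\<Sum>i<n. \<bar>\<phi> (u (Suc i)) - \<phi> (u i)\<bar>) + (\<Sum>i<n. \<bar>\<phi> (v (Suc i)) - \<phi> (v i)\<bar>)"
    unfolding sum.distrib[symmetric]
  proof (rule sum_mono)
    fix i assume "i \<in> {..<n}"
    then have "t i \<le> t (Suc i)" using t(1) by (auto simp: mono_on_def)
    then show "\<bar>\<phi> (t (Suc i)) - \<phi> (t i)\<bar>
        \<le> \<bar>\<phi> (u (Suc i)) - \<phi> (u i)\<bar> + \<bar>\<phi> (v (Suc i)) - \<phi> (v i)\<bar>"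
      unfolding u_def v_def min_def max_def by (auto split: if_splits)
  qed
  also have "\<dots> \<le> total_variation a b \<phi> + total_variation b c \<phi>"
    using variation_sum_le[OF assms(3) u] variation_sum_le[OF assms(4) v] by linarith
  finally show "(\<Sum>i<n. \<bar>\<phi> (t (Suc i)) - \<phi> (t i)\<bar>) \<le> total_variation a b \<phi> + total_variation b c \<phi>" .
qed

text \<open>Concatenating partitions of the two halves gives a partition of the whole, whose sum
  exceeds the two given ones by the jump between them.\<close>

lemma total_variation_combine_ge:
  assumes "a \<le> b" "b \<le> c" and bv: "bounded_variation a c \<phi>"
  shows "total_variation a b \<phi> + total_variation b c \<phi> \<le> total_variation a c \<phi>"
proof -
  have sums: "(\<Sum>i<n. \<bar>\<phi> (u (Suc i)) - \<phi> (u i)\<bar>) + (\<Sum>i<m. \<bar>\<phi> (v (Suc i)) - \<phi> (v i)\<bar>)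
      \<le> total_variation a c \<phi>"
    if u: "mono_on {..n} u" "u ` {..n} \<subseteq> {a..b}" and v: "mono_on {..m} v" "v ` {..m} \<subseteq> {b..c}"
    for n m u v
  proof -
    \<comment> \<open>The \<open>n + 1\<close> points of \<open>u\<close> are followed by the
      \<open>m + 1\<close> points of \<open>v\<close>. Among the \<open>n + Suc m\<close> gaps, the
      one with index \<open>n\<close> joins the end of \<open>u\<close> to the start of
      \<open>v\<close> and contributes a nonnegative term.\<close>
    define w where "w i = (if i \<le> n then u i else v (i - Suc n))" for i
    have uv: "u i \<le> b" if "i \<le> n" for i using u(2) that by (auto simp: image_subset_iff)
    have vb: "b \<le> v j" if "j \<le> m" for j using v(2) that by (auto simp: image_subset_iff)
    have "mono_on {..n + Suc m} w"
    proof (rule mono_onI)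
      fix i j assume ij: "i \<in> {..n + Suc m}" "j \<in> {..n + Suc m}" "i \<le> j"
      consider "j \<le> n" | "i \<le> n" "n < j" | "n < i" by linarith
      then show "w i \<le> w j"
      proof cases
        case 1 then show ?thesis using u(1) ij by (auto simp: w_def mono_on_def)
      next
        case 2
        then have "u i \<le> b" "b \<le> v (j - Suc n)" using uv vb ij by auto
        then show ?thesis using 2 by (simp add: w_def)
      next
        case 3
        then have "i - Suc n \<le> j - Suc n" "j - Suc n \<le> m" using ij by auto
        then show ?thesis using v(1) 3 ij(3) by (auto simp: w_def mono_on_def)
      qed
    qed
    moreover have "w i \<in> {a..c}" if "i \<le> n + Suc m" for i
    proof (cases "i \<le> n")
      case True
      then have "u i \<in> {a..b}" using u(2) by auto
      then show ?thesis using True assms(1,2) by (auto simp: w_def)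
    next
      case False
      then have "i - Suc n \<in> {..m}" using that by auto
      then have "v (i - Suc n) \<in> {b..c}" using v(2) by blast
      then show ?thesis using False assms(1,2) by (auto simp: w_def)
    qed
    ultimately have le: "(\<Sum>i<n + Suc m. \<bar>\<phi> (w (Suc i)) - \<phi> (w i)\<bar>) \<le> total_variation a c \<phi>"
      by (intro variation_sum_le[OF bv]) auto
    have split: "(\<Sum>i<n + Suc m. g i) = (\<Sum>i<n. g i) + g n + (\<Sum>j<m. g (Suc n + j))"
      for g :: "nat \<Rightarrow> real"
      by (induction m) auto
    have "(\<Sum>i<n. \<bar>\<phi> (w (Suc i)) - \<phi> (w i)\<bar>) = (\<Sum>i<n. \<bar>\<phi> (u (Suc i)) - \<phi> (u i)\<bar>)"
      by (intro sum.cong) (simp_all add: w_def)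
    moreover have "(\<Sum>i<m. \<bar>\<phi> (w (Suc (Suc n + i))) - \<phi> (w (Suc n + i))\<bar>)
        = (\<Sum>i<m. \<bar>\<phi> (v (Suc i)) - \<phi> (v i)\<bar>)"
      by (intro sum.cong) (simp_all add: w_def)
    ultimately show ?thesis
      using le abs_ge_zero[of "\<phi> (w (Suc n)) - \<phi> (w n)"]
        split[of "\<lambda>i. \<bar>\<phi> (w (Suc i)) - \<phi> (w i)\<bar>"] by linarith
  qed
  \<comment> \<open>The two suprema are taken one after the other: first over the left half with a
    fixed sum \<open>s\<close> on the right, then over \<open>s\<close>.\<close>
  have "total_variation a b \<phi> \<le> total_variation a c \<phi> - s"
    if s: "s \<in> variation_sums b c \<phi>" for s
  proof -
    obtain m v where "mono_on {..m} v" "v ` {..m} \<subseteq> {b..c}"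
      "s = (\<Sum>i<m. \<bar>\<phi> (v (Suc i)) - \<phi> (v i)\<bar>)"
      using s unfolding variation_sums_def by blast
    then show ?thesis
      by (intro conjunct2[OF variation_leI[OF \<open>a \<le> b\<close>]]) (simp add: le_diff_eq sums)
  qed
  note tv_le = this
  have le: "s \<le> total_variation a c \<phi> - total_variation a b \<phi>"
    if "s \<in> variation_sums b c \<phi>" for s
    using tv_le[OF that] by linarith
  have "total_variation b c \<phi> \<le> total_variation a c \<phi> - total_variation a b \<phi>"
    using variation_leI[OF \<open>b \<le> c\<close>, of \<phi> "total_variation a c \<phi> - total_variation a b \<phi>"] le
    unfolding variation_sums_def by blast
  then show ?thesis by simp
qed

text \<open>Cut the period starting at \<open>c\<close> at the integer inside it. With
  \<open>d\<close> the fractional part of \<open>c\<close>, integer translations turn the two pieces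
  into \<open>[d, 1]\<close> and \<open>[0, d]\<close>, which recombine to \<open>[0, 1]\<close>.
  This is what makes the variation on the circle independent of the base point.\<close>

lemma total_variation_periodic:
  assumes per: "\<And>x. p (x + 1) = p x" and bv: "bounded_variation 0 1 p"
  shows "bounded_variation c (c + 1) p \<and> total_variation c (c + 1) p \<le> total_variation 0 1 p"
proof -
  have nat: "p (x + of_nat k) = p x" for x k
    by (induction k) (use per in \<open>auto simp: add.assoc[symmetric] add.commute[of 1]\<close>)
  have int: "p (x - of_int k) = p x" for x k
    using nat[of "x - of_int k" "nat k"] nat[of x "nat (- k)"] by (cases "0 \<le> k") auto
  define k where "k = \<lfloor>c\<rfloor>"
  define d where "d = c - of_int k"
  have d: "0 \<le> d" "d \<le> 1" unfolding d_def k_def by linarith+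
  have bvd: "bounded_variation 0 d p" "bounded_variation d 1 p"
    using bounded_variation_subset[OF bv] d by auto
  have 1: "bounded_variation c (of_int k + 1) p \<and>
      total_variation c (of_int k + 1) p \<le> total_variation d 1 p"
    by (rule total_variation_comp[where g = "\<lambda>x. x - of_int k"])
      (use d bvd int in \<open>auto simp: d_def mono_on_def\<close>)
  have 2: "bounded_variation (of_int k + 1) (c + 1) p \<and>
      total_variation (of_int k + 1) (c + 1) p \<le> total_variation 0 d p"
    by (rule total_variation_comp[where g = "\<lambda>x. x - of_int (k + 1)"])
      (use d bvd int[of _ "k + 1"] in \<open>auto simp: d_def mono_on_def image_subset_iff\<close>)
  show ?thesis
    using total_variation_combine_le[of c "of_int k + 1" "c + 1" p] 1 2 d
      total_variation_combine_ge[OF d bv] unfolding d_def by linarith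
qed


section \<open>Subadditive sequences\<close>

text \<open>Fekete's lemma: the quotients tend to their infimum, which is finite by nonnegativity.
  Division with remainder by a nearly optimal \<open>m\<close> bounds all later quotients.\<close>

lemma subadditive_convergent:
  fixes u :: "nat \<Rightarrow> real"
  assumes nonneg: "\<And>n. 0 \<le> u n" and sub: "\<And>m n. u (m + n) \<le> u m + u n"
  shows "convergent (\<lambda>n. u n / real n)"
proof -
  define L where "L = (INF n\<in>{1..}. u n / real n)"
  have bdd: "bdd_below ((\<lambda>n. u n / real n) ` {1..})"
    by (rule bdd_belowI[of _ 0]) (auto simp: nonneg)
  have mult: "u (q * m + r) \<le> real q * u m + u r" for q m r
  proof (induction q)
    case (Suc q)
    then show ?case using sub[of m "q * m + r"] by (simp add: algebra_simps)
  qed simp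
  have "(\<lambda>n. u n / real n) \<longlonglongrightarrow> L"
  proof (rule LIMSEQ_I)
    fix e :: real assume "0 < e"
    have "L < L + e / 2" using \<open>0 < e\<close> by simp
    then have "\<exists>m\<in>{1..}. u m / real m < L + e / 2"
      unfolding L_def by (subst (asm) cINF_less_iff[OF _ bdd]) auto
    then obtain m where m: "1 \<le> m" "u m / real m < L + e / 2" by auto
    \<comment> \<open>\<open>C\<close> dominates \<open>u r\<close> for all remainders
      \<open>r < m\<close> at once, so its share vanishes after division by
      \<open>n\<close>.\<close>
    define C where "C = (\<Sum>r<m. u r)"
    have C: "u r \<le> C" if "r < m" for r
      unfolding C_def using that nonneg by (intro member_le_sum) auto
    obtain N :: nat where N: "2 * C / e < real N" using reals_Archimedean2 by blast
    show "\<exists>N. \<forall>n\<ge>N. norm (u n / real n - L) < e"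
    proof (intro exI[of _ "Suc N"] allI impI)
      fix n assume n: "Suc N \<le> n"
      have "u n \<le> real (n div m) * u m + u (n mod m)"
        using mult[of "n div m" m "n mod m"] by simp
      also have "\<dots> \<le> real n / real m * u m + C"
        using of_nat_div_le_of_nat[of n m, where ?'a = real] C[of "n mod m"] m(1) nonneg[of m]
        by (intro add_mono mult_right_mono) auto
      finally have "u n / real n \<le> u m / real m + C / real n"
        using n by (simp add: field_simps)
      moreover have "C / real n < e / 2"
      proof -
        have "2 * C / e < real n" using N n by linarith
        then show ?thesis using \<open>0 < e\<close> n by (simp add: field_simps)
      qed
      moreover have "L \<le> u n / real n"
        unfolding L_def using n by (intro cINF_lower[OF bdd]) auto
      ultimately show "norm (u n / real n - L) < e"
        using m(2) unfolding real_norm_def by linarith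
    qed
  qed
  then show ?thesis by (rule convergentI)
qed


section \<open>The averaging argument\<close>

text \<open>
  \<open>D\<close> is the group of diffeomorphisms, \<open>ld f\<close> is \<open>log (Df)\<close>, and \<open>V\<close> is the variation,
  meaningful on the class \<open>BV\<close>, which for the applications consists of the \<^emph>\<open>continuous\<close> functions
  of bounded variation, so that \<open>realize\<close> can be proved by integrating \<open>exp \<phi>\<close>.
\<close>

locale log_derivative_cocycle =
  fixes S :: "'a set" and D :: "('a \<Rightarrow> 'a) set" and ld :: "('a \<Rightarrow> 'a) \<Rightarrow> 'a \<Rightarrow> real"
    and BV :: "('a \<Rightarrow> real) \<Rightarrow> bool" and V :: "('a \<Rightarrow> real) \<Rightarrow> real"
  assumes bij: "f \<in> D \<Longrightarrow> bij_betw f S S"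
    and id_in: "id \<in> D"
    and comp_in: "f \<in> D \<Longrightarrow> g \<in> D \<Longrightarrow> f \<circ> g \<in> D"
    and inv_in: "f \<in> D \<Longrightarrow> inv_into S f \<in> D"
    and chain: "f \<in> D \<Longrightarrow> g \<in> D \<Longrightarrow> x \<in> S \<Longrightarrow> ld (f \<circ> g) x = ld f (g x) + ld g x"
    and ld_inv: "f \<in> D \<Longrightarrow> x \<in> S \<Longrightarrow> ld (inv_into S f) x = - ld f (inv_into S f x)"
    and ld_BV: "f \<in> D \<Longrightarrow> BV (ld f)"
    and cong: "BV \<phi> \<Longrightarrow> (\<And>x. x \<in> S \<Longrightarrow> \<psi> x = \<phi> x) \<Longrightarrow> BV \<psi> \<and> V \<psi> = V \<phi>"
    and nonneg: "BV \<phi> \<Longrightarrow> 0 \<le> V \<phi>"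
    and add: "BV \<phi> \<Longrightarrow> BV \<psi> \<Longrightarrow> BV (\<lambda>x. \<phi> x + \<psi> x) \<and> V (\<lambda>x. \<phi> x + \<psi> x) \<le> V \<phi> + V \<psi>"
    and scale: "BV \<phi> \<Longrightarrow> BV (\<lambda>x. c * \<phi> x) \<and> V (\<lambda>x. c * \<phi> x) \<le> \<bar>c\<bar> * V \<phi>"
    and const: "BV (\<lambda>x. c) \<and> V (\<lambda>x. c) = 0"
    and comp: "BV \<phi> \<Longrightarrow> f \<in> D \<Longrightarrow> BV (\<lambda>x. \<phi> (f x)) \<and> V (\<lambda>x. \<phi> (f x)) \<le> V \<phi>"
    and realize: "BV \<phi> \<Longrightarrow> \<exists>h\<in>D. \<exists>c. \<forall>x\<in>S. ld h x = \<phi> x + c"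
begin

section \<open>Iterates and existence of the asymptotic distortion\<close>

lemma in_S: "f \<in> D \<Longrightarrow> x \<in> S \<Longrightarrow> f x \<in> S"
  using bij bij_betwE by blast

lemma pow_in: "f \<in> D \<Longrightarrow> f ^^ n \<in> D"
  by (induction n) (auto intro: comp_in id_in[unfolded id_def] simp: id_in)

text \<open>The chain rule for \<open>id \<circ> id\<close> reads \<open>t = t + t\<close>.\<close>

lemma ld_id: "x \<in> S \<Longrightarrow> ld id x = 0"
  using chain[OF id_in id_in, of x] by simp

lemma ld_pow_add:
  assumes "f \<in> D" "x \<in> S"
  shows "ld (f ^^ (m + n)) x = ld (f ^^ m) ((f ^^ n) x) + ld (f ^^ n) x"
  unfolding funpow_add using assms by (intro chain pow_in)

lemma ld_pow_Suc:
  assumes "f \<in> D" "x \<in> S"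
  shows "ld (f ^^ Suc n) x = ld (f ^^ n) (f x) + ld f x"
  using ld_pow_add[OF assms, of n 1] by simp

text \<open>By the cocycle identity the log-derivative of an iterate of order \<open>m + n\<close>
  is the sum of one for \<open>n\<close> and a reparametrised one for \<open>m\<close>, so the
  variations are subadditive.\<close>

lemma V_pow_convergent:
  assumes f: "f \<in> D"
  shows "convergent (\<lambda>n. V (ld (f ^^ n)) / real n)"
proof (rule subadditive_convergent)
  fix m n
  show "0 \<le> V (ld (f ^^ n))" by (intro nonneg ld_BV pow_in f)
  have 1: "BV (\<lambda>x. ld (f ^^ m) ((f ^^ n) x)) \<and> V (\<lambda>x. ld (f ^^ m) ((f ^^ n) x)) \<le> V (ld (f ^^ m))"
    by (intro comp ld_BV pow_in f)
  note 2 = add[OF conjunct1[OF this] ld_BV[OF pow_in[OF f, of n]]]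
  have "V (ld (f ^^ (m + n))) = V (\<lambda>x. ld (f ^^ m) ((f ^^ n) x) + ld (f ^^ n) x)"
    using cong[OF conjunct1[OF 2], of "ld (f ^^ (m + n))"] ld_pow_add[OF f] by simp
  then show "V (ld (f ^^ (m + n))) \<le> V (ld (f ^^ m)) + V (ld (f ^^ n))"
    using 1 2 by linarith
qed

section \<open>Effect of conjugation\<close>

lemma conj_in: "f \<in> D \<Longrightarrow> h \<in> D \<Longrightarrow> h \<circ> f \<circ> inv_into S h \<in> D"
  by (intro comp_in inv_in)

lemma ld_conj:
  assumes f: "f \<in> D" and h: "h \<in> D" and x: "x \<in> S"
  shows "ld (h \<circ> f \<circ> inv_into S h) x =
    ld h (f (inv_into S h x)) + ld f (inv_into S h x) - ld h (inv_into S h x)"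
  using chain[OF comp_in[OF h f] inv_in[OF h] x] chain[OF h f in_S[OF inv_in[OF h] x]]
    ld_inv[OF h x] by simp

text \<open>Write \<open>f^k\<close> as the conjugate of \<open>g^k\<close> back by
  \<open>h\<close>. The factor \<open>g^k\<close> contributes \<open>k\<close> reparametrised copies
  of \<open>ld g\<close>, and the two outer factors contribute \<open>ld h\<close> and
  \<open>- ld h \<circ> f^k\<close>, whence the constant 2.\<close>

lemma V_pow_le_conj:
  assumes f: "f \<in> D" and h: "h \<in> D"
  shows "V (ld (f ^^ k)) \<le> real k * V (ld (h \<circ> f \<circ> inv_into S h)) + 2 * V (ld h)"
proof -
  define g where "g = h \<circ> f \<circ> inv_into S h"
  have g: "g \<in> D" unfolding g_def by (intro conj_in f h)
  have gh: "ld g (h x) = ld h (f x) + ld f x - ld h x" if "x \<in> S" for x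
    using ld_conj[OF f h in_S[OF h that]] bij_betw_inv_into_left[OF bij[OF h] that]
    by (simp add: g_def)
  \<comment> \<open>\<open>\<psi> k x\<close> is the log-derivative of \<open>g^k\<close> at
    \<open>h x\<close>, expressed through the orbit of \<open>x\<close> under \<open>f\<close>, so
    that the induction never handles iterates of \<open>g\<close>.\<close>
  define \<psi> where "\<psi> k x = ld (f ^^ k) x + ld h ((f ^^ k) x) - ld h x" for k x
  have \<psi>: "BV (\<psi> k) \<and> V (\<psi> k) \<le> real k * V (ld g)"
  proof (induction k)
    case 0
    have "\<psi> 0 x = 0" if "x \<in> S" for x using ld_id[OF that] by (simp add: \<psi>_def id_def)
    then show ?case using cong[OF conjunct1[OF const], of "\<psi> 0" 0] const by simp
  next
    case (Suc k)
    have 1: "BV (\<lambda>x. \<psi> k (f x)) \<and> V (\<lambda>x. \<psi> k (f x)) \<le> V (\<psi> k)"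
      using Suc by (intro comp f) simp
    have 2: "BV (\<lambda>x. ld g (h x)) \<and> V (\<lambda>x. ld g (h x)) \<le> V (ld g)"
      by (intro comp ld_BV g h)
    note 3 = add[OF conjunct1[OF 1] conjunct1[OF 2]]
    have "\<psi> (Suc k) x = \<psi> k (f x) + ld g (h x)" if "x \<in> S" for x
      using ld_pow_Suc[OF f that, of k] gh[OF that] by (simp add: \<psi>_def funpow_swap1)
    then have "BV (\<psi> (Suc k)) \<and> V (\<psi> (Suc k)) = V (\<lambda>x. \<psi> k (f x) + ld g (h x))"
      by (rule cong[OF conjunct1[OF 3]])
    moreover have "V (\<lambda>x. \<psi> k (f x) + ld g (h x)) \<le> real k * V (ld g) + V (ld g)"
      using 1 2 3 Suc by linarith
    ultimately show ?case by (simp add: algebra_simps)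
  qed
  have 1: "BV (\<lambda>x. - 1 * ld h ((f ^^ k) x)) \<and> V (\<lambda>x. - 1 * ld h ((f ^^ k) x)) \<le> V (ld h)"
    using comp[OF ld_BV[OF h] pow_in[OF f, of k]] scale[of "\<lambda>x. ld h ((f ^^ k) x)" "-1"] by auto
  note 2 = add[OF conjunct1[OF \<psi>] conjunct1[OF 1]]
  note 3 = add[OF conjunct1[OF 2] ld_BV[OF h]]
  have "V (ld (f ^^ k)) = V (\<lambda>x. \<psi> k x + - 1 * ld h ((f ^^ k) x) + ld h x)"
    using cong[OF conjunct1[OF 3], of "ld (f ^^ k)"] by (simp add: \<psi>_def)
  then show ?thesis using \<psi> 1 2 3 unfolding g_def[symmetric] by (smt (verit))
qed

lemma BV_sum: "(\<And>i. i < n \<Longrightarrow> BV (\<phi> i)) \<Longrightarrow> BV (\<lambda>x. \<Sum>i<n. \<phi> i x)" for n :: nat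
  by (induction n) (use add const in auto)

text \<open>
  The conjugacy has \<open>log Dh = (\<Sum>i<n. log Df\<^sup>i) / n\<close> up to a constant; then the logarithmic
  derivative of the conjugate telescopes to \<open>(log Df\<^sup>n) / n\<close>.
\<close>

lemma ex_averaging_conjugacy:
  assumes f: "f \<in> D" and "0 < n"
  shows "\<exists>h\<in>D. V (ld (h \<circ> f \<circ> inv_into S h)) \<le> V (ld (f ^^ n)) / real n"
proof -
  have "BV (\<lambda>x. 1 / real n * (\<Sum>i<n. ld (f ^^ i) x))"
    by (intro conjunct1[OF scale] BV_sum ld_BV pow_in f)
  from realize[OF this] obtain h c where h: "h \<in> D"
    and ldh: "\<And>x. x \<in> S \<Longrightarrow> ld h x = 1 / real n * (\<Sum>i<n. ld (f ^^ i) x) + c" by blast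
  \<comment> \<open>The normalising constant \<open>c\<close> occurs in both
    \<open>ld h (f y)\<close> and \<open>ld h y\<close> and cancels.\<close>
  have tele: "ld h (f y) + ld f y - ld h y = 1 / real n * ld (f ^^ n) y" if y: "y \<in> S" for y
  proof -
    have "(\<Sum>i<n. ld (f ^^ i) (f y)) + real n * ld f y - (\<Sum>i<n. ld (f ^^ i) y)
        = (\<Sum>i<n. ld (f ^^ Suc i) y - ld (f ^^ i) y)"
      using ld_pow_Suc[OF f y] by (simp add: sum.distrib sum_subtractf del: funpow.simps)
    also have "\<dots> = ld (f ^^ n) y"
      using sum_lessThan_telescope[of "\<lambda>i. ld (f ^^ i) y" n] ld_id[OF y]
      by (simp add: id_def del: funpow.simps(2))
    finally show ?thesis
      using ldh[OF y] ldh[OF in_S[OF f y]] \<open>0 < n\<close> by (simp add: field_simps)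
  qed
  have 1: "BV (\<lambda>x. ld (f ^^ n) (inv_into S h x)) \<and>
      V (\<lambda>x. ld (f ^^ n) (inv_into S h x)) \<le> V (ld (f ^^ n))"
    by (intro comp ld_BV pow_in inv_in f h)
  note 2 = scale[OF conjunct1[OF 1], of "1 / real n"]
  have "V (ld (h \<circ> f \<circ> inv_into S h)) = V (\<lambda>x. 1 / real n * ld (f ^^ n) (inv_into S h x))"
    using cong[OF conjunct1[OF 2], of "ld (h \<circ> f \<circ> inv_into S h)"]
      ld_conj[OF f h] tele in_S[OF inv_in[OF h]] by simp
  also have "\<dots> \<le> V (ld (f ^^ n)) / real n"
    using 1 2 by (auto intro: order_trans simp: divide_right_mono)
  finally show ?thesis using h by blast
qed

text \<open>The distortion is at most the variation for every conjugate, and averaging conjugacies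
  come arbitrarily close to it. No isometry appears here: for the interval and the circle, small
  variation alone is later shown to force closeness to one.\<close>

theorem distortion_zero_iff:
  assumes f: "f \<in> D"
  shows "lim (\<lambda>n. V (ld (f ^^ n)) / real n) = 0 \<longleftrightarrow>
    (\<exists>h. (\<forall>n. h n \<in> D) \<and> (\<lambda>n. V (ld (h n \<circ> f \<circ> inv_into S (h n)))) \<longlonglongrightarrow> 0)"
proof -
  define L where "L = lim (\<lambda>n. V (ld (f ^^ n)) / real n)"
  have L: "(\<lambda>n. V (ld (f ^^ n)) / real n) \<longlonglongrightarrow> L"
    using V_pow_convergent[OF f] unfolding L_def convergent_LIMSEQ_iff .
  show ?thesis unfolding L_def[symmetric]
  proof
    assume "L = 0"
    \<comment> \<open>The averaging length is \<open>Suc n\<close> because an average needs at least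
      one iterate; \<open>LIMSEQ_Suc\<close> absorbs the shift.\<close>
    obtain h where h: "\<And>n. h n \<in> D"
      "\<And>n. V (ld (h n \<circ> f \<circ> inv_into S (h n))) \<le> V (ld (f ^^ Suc n)) / real (Suc n)"
      using ex_averaging_conjugacy[OF f, of "Suc _"] by (metis zero_less_Suc)
    have "(\<lambda>n. V (ld (h n \<circ> f \<circ> inv_into S (h n)))) \<longlonglongrightarrow> 0"
    proof (rule tendsto_sandwich[OF _ _ tendsto_const])
      show "(\<lambda>n. V (ld (f ^^ Suc n)) / real (Suc n)) \<longlonglongrightarrow> 0"
        using LIMSEQ_Suc[OF L] unfolding \<open>L = 0\<close> .
      show "\<forall>\<^sub>F n in sequentially. 0 \<le> V (ld (h n \<circ> f \<circ> inv_into S (h n)))"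
        by (intro always_eventually allI nonneg ld_BV conj_in f h)
    qed (use h in \<open>auto simp del: funpow.simps\<close>)
    then show "\<exists>h. (\<forall>n. h n \<in> D) \<and> (\<lambda>n. V (ld (h n \<circ> f \<circ> inv_into S (h n)))) \<longlonglongrightarrow> 0"
      using h(1) by blast
  next
    assume "\<exists>h. (\<forall>n. h n \<in> D) \<and> (\<lambda>n. V (ld (h n \<circ> f \<circ> inv_into S (h n)))) \<longlonglongrightarrow> 0"
    then obtain h where h: "\<And>n. h n \<in> D"
      and lim: "(\<lambda>n. V (ld (h n \<circ> f \<circ> inv_into S (h n)))) \<longlonglongrightarrow> 0" by blast
    \<comment> \<open>Here \<open>n\<close> is fixed and \<open>k\<close> grows, so
      \<open>2 * V (ld (h n)) / k\<close> tends to 0 even if \<open>V (ld (h n))\<close> is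
      unbounded in \<open>n\<close>.\<close>
    have "L \<le> V (ld (h n \<circ> f \<circ> inv_into S (h n)))" (is "_ \<le> ?v") for n
    proof (rule LIMSEQ_le[OF L])
      have "(\<lambda>k. ?v + 2 * V (ld (h n)) / real k) \<longlonglongrightarrow> ?v + 0"
        by (intro tendsto_intros lim_const_over_n)
      then show "(\<lambda>k. ?v + 2 * V (ld (h n)) / real k) \<longlonglongrightarrow> ?v" by simp
      show "\<exists>N. \<forall>k\<ge>N. V (ld (f ^^ k)) / real k \<le> ?v + 2 * V (ld (h n)) / real k"
        using V_pow_le_conj[OF f h[of n]] by (intro exI[of _ 1]) (auto simp: field_simps)
    qed
    then have "L \<le> 0" by (intro LIMSEQ_le_const[OF lim]) auto
    moreover have "0 \<le> L"
      by (rule LIMSEQ_le_const[OF L]) (auto intro!: divide_nonneg_nonneg nonneg ld_BV pow_in f)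
    ultimately show "L = 0" by simp
  qed
qed

end


section \<open>Increasing \<open>C\<^sup>1\<close> functions\<close>

text \<open>Derivatives within an arbitrary set \<open>S\<close> let one set of lemmas serve both
  \<open>{a..b}\<close>, with one-sided derivatives at the ends, and \<open>UNIV\<close>, where the
  lifts of circle maps live.\<close>

definition pos_C1_on :: "real set \<Rightarrow> (real \<Rightarrow> real) \<Rightarrow> (real \<Rightarrow> real) \<Rightarrow> bool" where
  "pos_C1_on S f f' \<longleftrightarrow>
     (\<forall>x\<in>S. (f has_real_derivative f' x) (at x within S) \<and> 0 < f' x) \<and> continuous_on S f'"

lemma pos_C1_onD:
  assumes "pos_C1_on S f f'" "x \<in> S"
  shows "(f has_real_derivative f' x) (at x within S)" "0 < f' x"
  using assms by (auto simp: pos_C1_on_def)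

lemma pos_C1_on_continuous: "pos_C1_on S f f' \<Longrightarrow> continuous_on S f"
  unfolding pos_C1_on_def by (meson DERIV_continuous continuous_on_eq_continuous_within)

lemma pos_C1_on_continuous_ln: "pos_C1_on S f f' \<Longrightarrow> continuous_on S (\<lambda>x. ln (f' x))"
  unfolding pos_C1_on_def by (auto intro!: continuous_on_ln)

lemma pos_C1_on_mvt:
  assumes f: "pos_C1_on S f f'" and "x < y" "{x..y} \<subseteq> S"
  obtains z where "z \<in> {x<..<y}" "f y - f x = f' z * (y - x)"
proof -
  have "\<exists>z\<in>{x<..<y}. f y - f x = (*) (f' z) (y - x)"
  proof (rule mvt_simple[OF \<open>x < y\<close>])
    fix z assume "x \<le> z" "z \<le> y"
    then have "(f has_real_derivative f' z) (at z within {x..y})"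
      using assms(3) by (intro DERIV_subset[OF pos_C1_onD(1)[OF f]]) auto
    then show "(f has_derivative (*) (f' z)) (at z within {x..y})"
      by (simp add: has_field_derivative_def)
  qed
  then show ?thesis using that by blast
qed

lemma pos_C1_on_less:
  assumes f: "pos_C1_on S f f'" and "x < y" "{x..y} \<subseteq> S"
  shows "f x < f y"
proof -
  obtain z where z: "z \<in> {x<..<y}" "f y - f x = f' z * (y - x)"
    using pos_C1_on_mvt[OF assms] .
  then have "0 < f' z" using assms(3) by (intro pos_C1_onD(2)[OF f]) auto
  then have "0 < f' z * (y - x)" using \<open>x < y\<close> by simp
  then show ?thesis using z(2) by simp
qed

lemma pos_C1_on_mono:
  assumes "pos_C1_on S f f'" "{a..b} \<subseteq> S"
  shows "mono_on {a..b} f"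
proof (rule mono_onI)
  fix x y assume "x \<in> {a..b}" "y \<in> {a..b}" "x \<le> y"
  then have "x < y \<Longrightarrow> f x < f y" using assms(2) by (intro pos_C1_on_less[OF assms(1)]) auto
  then show "f x \<le> f y" using \<open>x \<le> y\<close> by fastforce
qed

lemma pos_C1_on_comp:
  assumes f: "pos_C1_on T f f'" and g: "pos_C1_on S g g'" and "g ` S \<subseteq> T"
  shows "pos_C1_on S (f \<circ> g) (\<lambda>x. f' (g x) * g' x)"
  unfolding pos_C1_on_def
proof (intro conjI ballI)
  fix x assume x: "x \<in> S"
  then have gx: "g x \<in> T" using assms(3) by auto
  show "(f \<circ> g has_real_derivative f' (g x) * g' x) (at x within S)"
    using DERIV_subset[OF pos_C1_onD(1)[OF f gx] assms(3)]
    by (rule DERIV_image_chain) (rule pos_C1_onD(1)[OF g x])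
  show "0 < f' (g x) * g' x"
    using pos_C1_onD(2)[OF f gx] pos_C1_onD(2)[OF g x] by simp
next
  show "continuous_on S (\<lambda>x. f' (g x) * g' x)"
    using f g assms(3) pos_C1_on_continuous[OF g] unfolding pos_C1_on_def
    by (intro continuous_on_mult continuous_on_compose2[of T f' S g]) auto
qed

section \<open>Inverses and closeness to isometries\<close>

text \<open>The difference quotient of \<open>g\<close> at \<open>y\<close> is the reciprocal of
  that of \<open>f\<close> at \<open>g y\<close>. The relation \<open>f (g z) = z\<close> makes
  \<open>g\<close> injective on \<open>T\<close>, so no denominator vanishes.\<close>

lemma DERIV_inverse_within:
  fixes f g :: "real \<Rightarrow> real"
  assumes f: "(f has_real_derivative d) (at (g y) within S)" and "d \<noteq> 0"
    and y: "y \<in> T" and gT: "g ` T \<subseteq> S" and fg: "\<And>z. z \<in> T \<Longrightarrow> f (g z) = z"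
    and cont: "continuous_on T g"
  shows "(g has_real_derivative 1 / d) (at y within T)"
proof -
  have "(g \<longlongrightarrow> g y) (at y within T)"
    using cont y by (auto simp: continuous_on_def)
  moreover have "\<forall>\<^sub>F z in at y within T. g z \<in> S \<and> g z \<noteq> g y"
    using gT fg y unfolding eventually_at_filter by (intro always_eventually) (metis image_subset_iff)
  ultimately have "filterlim g (at (g y) within S) (at y within T)"
    by (simp add: filterlim_at)
  with f have "((\<lambda>z. (f (g z) - f (g y)) / (g z - g y)) \<longlongrightarrow> d) (at y within T)"
    unfolding has_field_derivative_iff by (rule filterlim_compose)
  then have "((\<lambda>z. inverse ((f (g z) - f (g y)) / (g z - g y))) \<longlongrightarrow> inverse d) (at y within T)"
    using \<open>d \<noteq> 0\<close> by (rule tendsto_inverse)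
  moreover have "\<forall>\<^sub>F z in at y within T.
      inverse ((f (g z) - f (g y)) / (g z - g y)) = (g z - g y) / (z - y)"
    unfolding eventually_at_filter using fg y by (intro always_eventually) auto
  ultimately have "((\<lambda>z. (g z - g y) / (z - y)) \<longlongrightarrow> inverse d) (at y within T)"
    by (rule Lim_transform_eventually)
  then show ?thesis
    unfolding has_field_derivative_iff by (simp add: inverse_eq_divide)
qed

text \<open>Continuity of \<open>g\<close> is a hypothesis because its source differs: compactness
  on the interval, a local inverse theorem on the line.\<close>

lemma pos_C1_on_inverse:
  assumes f: "pos_C1_on S f f'" and gS: "g ` S \<subseteq> S" and fg: "\<And>z. z \<in> S \<Longrightarrow> f (g z) = z"
    and cont: "continuous_on S g"
  shows "pos_C1_on S g (\<lambda>y. 1 / f' (g y))"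
  unfolding pos_C1_on_def
proof (intro conjI ballI)
  fix y assume y: "y \<in> S"
  then have gy: "g y \<in> S" using gS by auto
  show "(g has_real_derivative 1 / f' (g y)) (at y within S)"
    using pos_C1_onD[OF f gy] by (intro DERIV_inverse_within[OF _ _ y gS fg cont]) auto
  show "0 < 1 / f' (g y)" using pos_C1_onD(2)[OF f gy] by simp
next
  show "continuous_on S (\<lambda>y. 1 / f' (g y))"
    using f gS cont pos_C1_onD(2)[OF f] unfolding pos_C1_on_def
    by (intro continuous_on_divide continuous_on_const continuous_on_compose2[of S f' S g]) fastforce+
qed

text \<open>For negative \<open>t\<close> the deviation \<open>1 - exp t\<close> is at most
  \<open>exp (- t) - 1\<close>, because \<open>exp t + exp (- t)\<close> is at least 2. So a
  two-sided bound on a logarithm needs only one error term.\<close>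

lemma exp_bound_near_one:
  fixes t v :: real
  assumes "\<bar>t\<bar> \<le> v"
  shows "\<bar>exp t - 1\<bar> \<le> exp v - 1"
proof (cases "0 \<le> t")
  case True then show ?thesis using assms by simp
next
  case False
  have "2 \<le> exp t + exp (- t)"
    using exp_ge_add_one_self[of t] exp_ge_add_one_self[of "- t"] by linarith
  moreover have "exp (- t) \<le> exp v" using assms by simp
  moreover have "exp t \<le> 1" using False by simp
  ultimately show ?thesis by linarith
qed

text \<open>The displacement \<open>g x - x\<close> has derivative \<open>g' - 1\<close>, hence is
  Lipschitz with constant \<open>exp v - 1\<close>. Knowing it at a single point then controls it
  everywhere on a bounded set.\<close>

lemma pos_C1_on_near_isometry:
  assumes g: "pos_C1_on S g g'" and v: "\<And>x. x \<in> S \<Longrightarrow> \<bar>ln (g' x)\<bar> \<le> v"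
  shows "x \<in> S \<Longrightarrow> \<bar>g' x - 1\<bar> \<le> exp v - 1"
    and "convex S \<Longrightarrow> x \<in> S \<Longrightarrow> y \<in> S \<Longrightarrow> \<bar>(g x - x) - (g y - y)\<bar> \<le> (exp v - 1) * \<bar>x - y\<bar>"
proof -
  show d: "\<bar>g' x - 1\<bar> \<le> exp v - 1" if "x \<in> S" for x
    using exp_bound_near_one[OF v[OF that]] pos_C1_onD(2)[OF g that] by simp
  have "((\<lambda>x. g x - x) has_real_derivative g' z - 1) (at z within S)" if "z \<in> S" for z
    using pos_C1_onD(1)[OF g that] by (intro DERIV_diff DERIV_ident)
  then show "\<bar>(g x - x) - (g y - y)\<bar> \<le> (exp v - 1) * \<bar>x - y\<bar>" if "convex S" "x \<in> S" "y \<in> S"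
    using field_differentiable_bound[OF \<open>convex S\<close>, of "\<lambda>x. g x - x" "\<lambda>x. g' x - 1" "exp v - 1" x y]
      d that by simp
qed

lemma uniform_limitI_bound:
  assumes "\<And>n x. x \<in> S \<Longrightarrow> dist (F n x) (R x) \<le> c n" "c \<longlonglongrightarrow> (0::real)"
  shows "uniform_limit S F R sequentially"
proof (rule uniform_limitI)
  fix e :: real assume "0 < e"
  then have "\<forall>\<^sub>F n in sequentially. c n < e" using assms(2) by (simp add: order_tendstoD)
  then show "\<forall>\<^sub>F n in sequentially. \<forall>x\<in>S. dist (F n x) (R x) < e"
    by eventually_elim (use assms(1) in \<open>auto intro: le_less_trans\<close>)
qed


section \<open>The interval\<close>

text \<open>Nondegeneracy of the interval makes one-sided derivatives unique.\<close>

lemma ivl_deriv_eq: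
  assumes "a < b" "x \<in> {a..b}" "(f has_real_derivative d) (at x within {a..b})"
  shows "ivl_deriv a b f x = d"
  unfolding ivl_deriv_def using assms
  by (intro vector_derivative_within_closed_interval)
    (auto simp: has_real_derivative_iff_has_vector_derivative)

lemma ivl_C1_diffeoD:
  assumes "ivl_C1_diffeo a b f"
  shows "pos_C1_on {a..b} f (ivl_deriv a b f)" "bij_betw f {a..b} {a..b}"
  using assms unfolding ivl_C1_diffeo_def pos_C1_on_def
  by (auto simp: ivl_deriv_def vector_derivative_works has_real_derivative_iff_has_vector_derivative)

lemma ivl_C1_diffeoI:
  assumes "a < b" "pos_C1_on {a..b} f f'" "bij_betw f {a..b} {a..b}"
  shows "ivl_C1_diffeo a b f"
proof -
  have eq: "ivl_deriv a b f x = f' x" if "x \<in> {a..b}" for x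
    using ivl_deriv_eq[OF assms(1) that] pos_C1_onD(1)[OF assms(2) that] by blast
  have "f differentiable (at x within {a..b})" if "x \<in> {a..b}" for x
    using pos_C1_onD(1)[OF assms(2) that]
    by (meson differentiableI_vector has_real_derivative_iff_has_vector_derivative)
  moreover have "continuous_on {a..b} (ivl_deriv a b f)"
    using assms(2) continuous_on_cong[OF refl eq, of "{a..b}" "\<lambda>x. x"]
    by (simp add: pos_C1_on_def)
  ultimately show ?thesis
    using assms(3) eq pos_C1_onD(2)[OF assms(2)] unfolding ivl_C1_diffeo_def by auto
qed

text \<open>Strict monotonicity gives injectivity and the intermediate value theorem surjectivity.
  One direction certifies constructed conjugacies; the other supplies the fixed endpoints that
  anchor all estimates on the interval.\<close>

lemma pos_C1_on_bij_betw_iff: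
  assumes "a < b" "pos_C1_on {a..b} f f'"
  shows "bij_betw f {a..b} {a..b} \<longleftrightarrow> f a = a \<and> f b = b"
proof
  note mono = mono_onD[OF pos_C1_on_mono[OF assms(2) order_refl]]
  show "f a = a \<and> f b = b" if bij: "bij_betw f {a..b} {a..b}"
  proof -
    obtain x y where "x \<in> {a..b}" "f x = a" "y \<in> {a..b}" "f y = b"
      using bij \<open>a < b\<close> unfolding bij_betw_def
      by (metis atLeastAtMost_iff imageE less_eq_real_def)
    moreover have "f a \<in> {a..b}" "f b \<in> {a..b}"
      using bij \<open>a < b\<close> by (auto simp: bij_betw_def)
    ultimately show ?thesis
      using mono[of a x] mono[of y b] \<open>a < b\<close> by auto
  qed
  show "bij_betw f {a..b} {a..b}" if ends: "f a = a \<and> f b = b"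
    unfolding bij_betw_def
  proof
    show "inj_on f {a..b}"
      by (rule linorder_inj_onI) (use pos_C1_on_less[OF assms(2)] in fastforce)+
    have "y \<in> f ` {a..b}" if "y \<in> {a..b}" for y
      using IVT'[of f a y b] pos_C1_on_continuous[OF assms(2)] that ends \<open>a < b\<close> by auto
    moreover have "f x \<in> {a..b}" if "x \<in> {a..b}" for x
      using mono[of a x] mono[of x b] that ends by auto
    ultimately show "f ` {a..b} = {a..b}" by blast
  qed
qed

lemma ivl_C1_diffeo_inverse:
  assumes "a < b" "ivl_C1_diffeo a b f"
  defines "g \<equiv> inv_into {a..b} f"
  shows "pos_C1_on {a..b} g (\<lambda>y. 1 / ivl_deriv a b f (g y))" "bij_betw g {a..b} {a..b}"
proof -
  note f = ivl_C1_diffeoD[OF assms(2)]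
  show bij: "bij_betw g {a..b} {a..b}" unfolding g_def by (rule bij_betw_inv_into[OF f(2)])
  have "continuous_on (f ` {a..b}) g"
    using bij_betw_inv_into_left[OF f(2)]
    by (intro continuous_on_inv pos_C1_on_continuous[OF f(1)]) (auto simp: g_def)
  then have "continuous_on {a..b} g" using f(2) by (simp add: bij_betw_def)
  then show "pos_C1_on {a..b} g (\<lambda>y. 1 / ivl_deriv a b f (g y))"
    using bij bij_betw_inv_into_right[OF f(2)]
    by (intro pos_C1_on_inverse[OF f(1)]) (auto simp: g_def bij_betw_def)
qed

lemma ivl_log_derivative_cocycle:
  assumes "a < b"
  shows "log_derivative_cocycle {a..b} (Collect (ivl_C1bv_diffeo a b)) (\<lambda>f x. ln (ivl_deriv a b f x))
    (\<lambda>\<phi>. continuous_on {a..b} \<phi> \<and> bounded_variation a b \<phi>) (total_variation a b)"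
proof -
  have ab: "a \<le> b" using \<open>a < b\<close> by simp
  have self: "f ` {a..b} \<subseteq> {a..b}" if "ivl_C1_diffeo a b f" for f
    using ivl_C1_diffeoD(2)[OF that] by (simp add: bij_betw_def)
  have comp: "(continuous_on {a..b} \<phi> \<and> bounded_variation a b \<phi> \<longrightarrow>
        continuous_on {a..b} (\<lambda>x. \<phi> (f x)) \<and> bounded_variation a b (\<lambda>x. \<phi> (f x))) \<and>
      (bounded_variation a b \<phi> \<longrightarrow> total_variation a b (\<lambda>x. \<phi> (f x)) \<le> total_variation a b \<phi>)"
    if f: "pos_C1_on {a..b} f f'" "f ` {a..b} \<subseteq> {a..b}" for \<phi> f f'
    using total_variation_comp[OF ab pos_C1_on_mono[OF f(1) order_refl] f(2), of \<phi>]
      continuous_on_compose2[OF _ pos_C1_on_continuous[OF f(1)] f(2), of \<phi>] by auto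
  have chain: "ivl_C1_diffeo a b (f \<circ> g)"
      "\<And>x. x \<in> {a..b} \<Longrightarrow> ln (ivl_deriv a b (f \<circ> g) x) = ln (ivl_deriv a b f (g x)) + ln (ivl_deriv a b g x)"
    if f: "ivl_C1_diffeo a b f" and g: "ivl_C1_diffeo a b g" for f g
  proof -
    note fg = pos_C1_on_comp[OF ivl_C1_diffeoD(1)[OF f] ivl_C1_diffeoD(1)[OF g] self[OF g]]
    show "ivl_C1_diffeo a b (f \<circ> g)"
      using bij_betw_trans[OF ivl_C1_diffeoD(2)[OF g] ivl_C1_diffeoD(2)[OF f]]
      by (rule ivl_C1_diffeoI[OF \<open>a < b\<close> fg])
    fix x assume x: "x \<in> {a..b}"
    then have "g x \<in> {a..b}" using self[OF g] by blast
    then show "ln (ivl_deriv a b (f \<circ> g) x) = ln (ivl_deriv a b f (g x)) + ln (ivl_deriv a b g x)"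
      using ivl_deriv_eq[OF \<open>a < b\<close> x pos_C1_onD(1)[OF fg x]]
        pos_C1_onD(2)[OF ivl_C1_diffeoD(1)[OF f], of "g x"]
        pos_C1_onD(2)[OF ivl_C1_diffeoD(1)[OF g] x]
      by (simp add: ln_mult_pos)
  qed
  have inv: "ivl_C1_diffeo a b (inv_into {a..b} f)"
      "\<And>x. x \<in> {a..b} \<Longrightarrow>
        ln (ivl_deriv a b (inv_into {a..b} f) x) = - ln (ivl_deriv a b f (inv_into {a..b} f x))"
    if f: "ivl_C1_diffeo a b f" for f
  proof -
    note i = ivl_C1_diffeo_inverse[OF \<open>a < b\<close> f]
    show "ivl_C1_diffeo a b (inv_into {a..b} f)" by (rule ivl_C1_diffeoI[OF \<open>a < b\<close> i])
    fix x assume x: "x \<in> {a..b}"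
    then show "ln (ivl_deriv a b (inv_into {a..b} f) x) = - ln (ivl_deriv a b f (inv_into {a..b} f x))"
      using ivl_deriv_eq[OF \<open>a < b\<close> x pos_C1_onD(1)[OF i(1) x]] pos_C1_onD(2)[OF i(1) x]
      by (simp add: ln_div)
  qed
  show ?thesis
  proof
    fix f g assume "f \<in> Collect (ivl_C1bv_diffeo a b)" "g \<in> Collect (ivl_C1bv_diffeo a b)"
    then have f: "ivl_C1_diffeo a b f" "bounded_variation a b (\<lambda>x. ln (ivl_deriv a b f x))"
      and g: "ivl_C1_diffeo a b g" "bounded_variation a b (\<lambda>x. ln (ivl_deriv a b g x))"
      by (auto simp: ivl_C1bv_diffeo_def)
    show "bij_betw f {a..b} {a..b}" by (rule ivl_C1_diffeoD(2)[OF f(1)])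
    show "continuous_on {a..b} (\<lambda>x. ln (ivl_deriv a b f x)) \<and>
        bounded_variation a b (\<lambda>x. ln (ivl_deriv a b f x))"
      using pos_C1_on_continuous_ln[OF ivl_C1_diffeoD(1)[OF f(1)]] f(2) by simp
    show "x \<in> {a..b} \<Longrightarrow>
        ln (ivl_deriv a b (f \<circ> g) x) = ln (ivl_deriv a b f (g x)) + ln (ivl_deriv a b g x)" for x
      by (rule chain(2)[OF f(1) g(1)])
    show "x \<in> {a..b} \<Longrightarrow>
        ln (ivl_deriv a b (inv_into {a..b} f) x) = - ln (ivl_deriv a b f (inv_into {a..b} f x))" for x
      by (rule inv(2)[OF f(1)])
    have "bounded_variation a b (\<lambda>x. ln (ivl_deriv a b f (g x)) + ln (ivl_deriv a b g x))"
      using comp[OF ivl_C1_diffeoD(1)[OF g(1)] self[OF g(1)], of "\<lambda>x. ln (ivl_deriv a b f x)"]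
        pos_C1_on_continuous_ln[OF ivl_C1_diffeoD(1)[OF f(1)]] f(2) g(2)
      by (intro conjunct1[OF total_variation_add[OF ab]]) auto
    from total_variation_cong[OF ab this, of "\<lambda>x. ln (ivl_deriv a b (f \<circ> g) x)"]
    show "f \<circ> g \<in> Collect (ivl_C1bv_diffeo a b)"
      using chain[OF f(1) g(1)] by (simp add: ivl_C1bv_diffeo_def)
    have "bounded_variation a b (\<lambda>x. - 1 * ln (ivl_deriv a b f (inv_into {a..b} f x)))"
      using comp[OF ivl_C1_diffeoD(1)[OF inv(1)[OF f(1)]] self[OF inv(1)[OF f(1)]],
          of "\<lambda>x. ln (ivl_deriv a b f x)"]
        pos_C1_on_continuous_ln[OF ivl_C1_diffeoD(1)[OF f(1)]] f(2)
      by (intro conjunct1[OF total_variation_scale[OF ab]]) auto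
    from total_variation_cong[OF ab this, of "\<lambda>x. ln (ivl_deriv a b (inv_into {a..b} f) x)"]
    show "inv_into {a..b} f \<in> Collect (ivl_C1bv_diffeo a b)"
      using inv[OF f(1)] by (simp add: ivl_C1bv_diffeo_def)
    show "continuous_on {a..b} \<phi> \<and> bounded_variation a b \<phi> \<Longrightarrow>
        (continuous_on {a..b} (\<lambda>x. \<phi> (f x)) \<and> bounded_variation a b (\<lambda>x. \<phi> (f x))) \<and>
        total_variation a b (\<lambda>x. \<phi> (f x)) \<le> total_variation a b \<phi>" for \<phi>
      using comp[OF ivl_C1_diffeoD(1)[OF f(1)] self[OF f(1)], of \<phi>] by blast
  next
    have "pos_C1_on {a..b} id (\<lambda>_. 1)" by (auto simp: pos_C1_on_def id_def)
    moreover have "ivl_deriv a b id x = 1" if "x \<in> {a..b}" for x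
      using ivl_deriv_eq[OF \<open>a < b\<close> that DERIV_ident] by (simp add: id_def)
    ultimately show "id \<in> Collect (ivl_C1bv_diffeo a b)"
      using ivl_C1_diffeoI[OF \<open>a < b\<close>, of id] total_variation_const[OF ab, of 0]
        total_variation_cong[OF ab, of "\<lambda>_. 0" "\<lambda>x. ln (ivl_deriv a b id x)"]
      by (simp add: ivl_C1bv_diffeo_def)
  next
    fix \<phi> \<psi> :: "real \<Rightarrow> real"
    assume \<phi>: "continuous_on {a..b} \<phi> \<and> bounded_variation a b \<phi>"
    show "(\<And>x. x \<in> {a..b} \<Longrightarrow> \<psi> x = \<phi> x) \<Longrightarrow>
        (continuous_on {a..b} \<psi> \<and> bounded_variation a b \<psi>) \<and>
        total_variation a b \<psi> = total_variation a b \<phi>"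
      using total_variation_cong[OF ab, of \<phi> \<psi>] continuous_on_eq[of "{a..b}" \<phi> \<psi>] \<phi> by metis
    show "0 \<le> total_variation a b \<phi>" using total_variation_nonneg[OF ab] \<phi> by simp
    show "continuous_on {a..b} \<psi> \<and> bounded_variation a b \<psi> \<Longrightarrow>
        (continuous_on {a..b} (\<lambda>x. \<phi> x + \<psi> x) \<and> bounded_variation a b (\<lambda>x. \<phi> x + \<psi> x)) \<and>
        total_variation a b (\<lambda>x. \<phi> x + \<psi> x) \<le> total_variation a b \<phi> + total_variation a b \<psi>"
      using total_variation_add[OF ab, of \<phi> \<psi>] \<phi> by (auto intro: continuous_on_add)
    show "(continuous_on {a..b} (\<lambda>x. c * \<phi> x) \<and> bounded_variation a b (\<lambda>x. c * \<phi> x)) \<and>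
        total_variation a b (\<lambda>x. c * \<phi> x) \<le> \<bar>c\<bar> * total_variation a b \<phi>" for c
      using total_variation_scale[OF ab, of \<phi> c] \<phi> by (auto intro: continuous_on_mult_left)
    \<comment> \<open>The assumption \<open>realize\<close>: the integral of the positive continuous
      function \<open>exp \<phi>\<close> is increasing and C1, and \<open>h\<close> rescales it
      affinely so that both endpoints are fixed. The factor \<open>(b - a) / I b\<close> turns into
      the additive constant.\<close>
    define I where "I x = integral {a..x} (\<lambda>x. exp (\<phi> x))" for x
    have I: "pos_C1_on {a..b} I (\<lambda>x. exp (\<phi> x))"
      using \<phi> unfolding pos_C1_on_def I_def
      by (auto intro!: integral_has_real_derivative continuous_on_exp)
    have "I a = 0" by (simp add: I_def)
    then have "0 < I b" using pos_C1_on_less[OF I \<open>a < b\<close>] by simp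
    define h where "h x = a + (b - a) / I b * I x" for x
    have h: "pos_C1_on {a..b} h (\<lambda>x. (b - a) / I b * exp (\<phi> x))"
      using I \<open>0 < I b\<close> \<open>a < b\<close> unfolding pos_C1_on_def h_def
      by (auto intro!: derivative_eq_intros continuous_intros)
    have "h a = a" "h b = b" using \<open>I a = 0\<close> \<open>0 < I b\<close> by (simp_all add: h_def)
    then have C1: "ivl_C1_diffeo a b h"
      using pos_C1_on_bij_betw_iff[OF \<open>a < b\<close> h] by (intro ivl_C1_diffeoI[OF \<open>a < b\<close> h]) simp
    have ld: "ln (ivl_deriv a b h x) = \<phi> x + ln ((b - a) / I b)" if "x \<in> {a..b}" for x
    proof -
      have "0 < (b - a) / I b" using \<open>0 < I b\<close> \<open>a < b\<close> by simp
      then show ?thesis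
        unfolding ivl_deriv_eq[OF \<open>a < b\<close> that pos_C1_onD(1)[OF h that]]
        by (subst ln_mult_pos) auto
    qed
    have "bounded_variation a b (\<lambda>x. \<phi> x + ln ((b - a) / I b))"
      using total_variation_add[OF ab] total_variation_const[OF ab] \<phi> by blast
    from total_variation_cong[OF ab this, of "\<lambda>x. ln (ivl_deriv a b h x)"]
    have "h \<in> Collect (ivl_C1bv_diffeo a b)" using C1 ld by (simp add: ivl_C1bv_diffeo_def)
    then show "\<exists>h\<in>Collect (ivl_C1bv_diffeo a b). \<exists>c. \<forall>x\<in>{a..b}. ln (ivl_deriv a b h x) = \<phi> x + c"
      using ld by blast
  qed (use total_variation_const[OF ab] in auto)
qed

text \<open>Variation sees only differences. A zero of the log-derivative, found by the mean value
  theorem between the fixed endpoints, turns it into a bound on absolute values.\<close>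

lemma ivl_ln_deriv_le_variation:
  assumes "a < b" "ivl_C1bv_diffeo a b f" "x \<in> {a..b}"
  shows "\<bar>ln (ivl_deriv a b f x)\<bar> \<le> total_variation a b (\<lambda>x. ln (ivl_deriv a b f x))"
proof -
  have C1: "ivl_C1_diffeo a b f" and bv: "bounded_variation a b (\<lambda>x. ln (ivl_deriv a b f x))"
    using assms(2) by (auto simp: ivl_C1bv_diffeo_def)
  note f = ivl_C1_diffeoD[OF C1]
  obtain z where z: "z \<in> {a<..<b}" "f b - f a = ivl_deriv a b f z * (b - a)"
    using pos_C1_on_mvt[OF f(1) \<open>a < b\<close> order_refl] .
  then have "ivl_deriv a b f z = 1"
    using pos_C1_on_bij_betw_iff[OF \<open>a < b\<close> f(1)] f(2) \<open>a < b\<close> by simp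
  then show ?thesis
    using diff_le_total_variation[OF bv assms(3), of z] z(1) by auto
qed

theorem ivl_distortion_zero_iff:
  assumes "a < b" "ivl_C1bv_diffeo a b f"
  shows "ivl_asymptotic_distortion a b f = 0 \<longleftrightarrow>
    (\<exists>h. (\<forall>n. ivl_C1bv_diffeo a b (h n)) \<and>
      (\<exists>R. ivl_isometry a b R \<and>
        ivl_C1bv_converges a b (\<lambda>n. h n \<circ> f \<circ> inv_into {a..b} (h n)) R))"
proof -
  interpret log_derivative_cocycle "{a..b}" "Collect (ivl_C1bv_diffeo a b)"
    "\<lambda>f x. ln (ivl_deriv a b f x)" "\<lambda>\<phi>. continuous_on {a..b} \<phi> \<and> bounded_variation a b \<phi>"
    "total_variation a b"
    by (rule ivl_log_derivative_cocycle[OF \<open>a < b\<close>])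
  have conv: "ivl_C1bv_converges a b g id"
    if g: "\<And>n. ivl_C1bv_diffeo a b (g n)"
      and lim: "(\<lambda>n. total_variation a b (\<lambda>x. ln (ivl_deriv a b (g n) x))) \<longlonglongrightarrow> 0" for g
  proof -
    define v where "v n = total_variation a b (\<lambda>x. ln (ivl_deriv a b (g n) x))" for n
    have "(\<lambda>n. exp (v n) - 1) \<longlonglongrightarrow> exp 0 - 1"
      using lim unfolding v_def[symmetric] by (intro tendsto_intros)
    then have v0: "(\<lambda>n. exp (v n) - 1) \<longlonglongrightarrow> 0" by simp
    have C1: "ivl_C1_diffeo a b (g n)" for n using g by (simp add: ivl_C1bv_diffeo_def)
    note gC1 = ivl_C1_diffeoD[OF C1]
    have ln_le: "\<bar>ln (ivl_deriv a b (g n) x)\<bar> \<le> v n" if "x \<in> {a..b}" for n x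
      unfolding v_def by (rule ivl_ln_deriv_le_variation[OF \<open>a < b\<close> g that])
    have near: "x \<in> {a..b} \<Longrightarrow> \<bar>ivl_deriv a b (g n) x - 1\<bar> \<le> exp (v n) - 1"
      "x \<in> {a..b} \<Longrightarrow> y \<in> {a..b} \<Longrightarrow> \<bar>(g n x - x) - (g n y - y)\<bar> \<le> (exp (v n) - 1) * \<bar>x - y\<bar>"
      for n x y
      using pos_C1_on_near_isometry[OF gC1(1), where v = "v n"] ln_le by simp_all
    \<comment> \<open>The fixed endpoint anchors the displacement: \<open>near(2)\<close> with
      \<open>y = a\<close> bounds \<open>g n x - x\<close> itself.\<close>
    have "g n a = a" for n
      using pos_C1_on_bij_betw_iff[OF \<open>a < b\<close> gC1(1)] gC1(2) by blast
    have "dist (g n x) (id x) \<le> (exp (v n) - 1) * (b - a)" if x: "x \<in> {a..b}" for n x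
    proof -
      have "0 \<le> exp (v n) - 1" using near(1)[OF x, of n] by linarith
      moreover have "\<bar>x - a\<bar> \<le> b - a" using x by simp
      ultimately have "(exp (v n) - 1) * \<bar>x - a\<bar> \<le> (exp (v n) - 1) * (b - a)"
        by (rule mult_left_mono[rotated])
      then show ?thesis
        using near(2)[OF x, of a n] \<open>g n a = a\<close> \<open>a < b\<close> by (auto simp: dist_real_def)
    qed
    moreover have "(\<lambda>n. (exp (v n) - 1) * (b - a)) \<longlonglongrightarrow> 0"
      using tendsto_mult_right[OF v0, of "b - a"] by simp
    ultimately have "uniform_limit {a..b} g id sequentially" by (rule uniform_limitI_bound)
    moreover have "uniform_limit {a..b} (\<lambda>n. ivl_deriv a b (g n)) (\<lambda>_. 1) sequentially"
      by (rule uniform_limitI_bound[OF _ v0]) (simp add: dist_real_def near(1))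
    ultimately show ?thesis using lim by (simp add: ivl_C1bv_converges_def)
  qed
  have isom: "ivl_isometry a b id"
    using id_in by (simp add: ivl_isometry_def ivl_C1bv_diffeo_def)
  have iff: "ivl_asymptotic_distortion a b f = 0 \<longleftrightarrow> (\<exists>h. (\<forall>n. ivl_C1bv_diffeo a b (h n)) \<and>
      (\<lambda>n. total_variation a b (\<lambda>x. ln (ivl_deriv a b (h n \<circ> f \<circ> inv_into {a..b} (h n)) x))) \<longlonglongrightarrow> 0)"
    using distortion_zero_iff[of f] assms(2) unfolding ivl_asymptotic_distortion_def by simp
  show ?thesis
  proof
    assume "ivl_asymptotic_distortion a b f = 0"
    then obtain h where h: "\<And>n. ivl_C1bv_diffeo a b (h n)"
      and lim: "(\<lambda>n. total_variation a b
        (\<lambda>x. ln (ivl_deriv a b (h n \<circ> f \<circ> inv_into {a..b} (h n)) x))) \<longlonglongrightarrow> 0"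
      unfolding iff by blast
    have "ivl_C1bv_diffeo a b (h n \<circ> f \<circ> inv_into {a..b} (h n))" for n
      using conj_in[of f "h n"] assms(2) h by simp
    from conv[OF this lim] show "\<exists>h. (\<forall>n. ivl_C1bv_diffeo a b (h n)) \<and>
        (\<exists>R. ivl_isometry a b R \<and>
          ivl_C1bv_converges a b (\<lambda>n. h n \<circ> f \<circ> inv_into {a..b} (h n)) R)"
      using h isom by blast
  \<comment> \<open>The reverse implication reads off the variation clause of the convergence, with
    the same conjugacies.\<close>
  qed (auto simp: iff ivl_C1bv_converges_def)
qed


section \<open>The circle\<close>

lemma dist_to_circle: "dist (to_circle x) (to_circle y) = dist_to_int (x - y)"
  by transfer simp

lemma to_circle_add_1 [simp]: "to_circle (x + 1) = to_circle x"
  by (simp add: to_circle_eq_iff)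

lemma to_circle_cases:
  obtains x where "0 \<le> x" "x \<le> 1" "z = to_circle x"
proof -
  obtain y where "z = to_circle y" by transfer auto
  moreover have "to_circle y = to_circle (frac y)"
    by (simp add: to_circle_eq_iff frac_def)
  ultimately show ?thesis using that[of "frac y"] frac_lt_1[of y] by simp
qed

lemma degree_one_int:
  fixes F :: "real \<Rightarrow> real"
  assumes "\<And>x. F (x + 1) = F x + 1"
  shows "F (x + of_int k) = F x + of_int k"
proof -
  have nat: "F (x + of_nat n) = F x + of_nat n" for x n
    by (induction n) (use assms in \<open>auto simp: add.assoc[symmetric] add.commute[of 1]\<close>)
  show ?thesis
    using nat[of x "nat k"] nat[of "x + of_int k" "nat (- k)"] by (cases "0 \<le> k") auto
qed

section \<open>Lifts of degree one\<close>

text \<open>Packaging the lift with its derivative and degree one moves all arguments to the real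
  line; bijectivity of \<open>f\<close> is a consequence.\<close>

definition C1_lift :: "(circle \<Rightarrow> circle) \<Rightarrow> (real \<Rightarrow> real) \<Rightarrow> (real \<Rightarrow> real) \<Rightarrow> bool" where
  "C1_lift f F F' \<longleftrightarrow> pos_C1_on UNIV F F' \<and> (\<forall>x. F (x + 1) = F x + 1) \<and>
     (\<forall>x. to_circle (F x) = f (to_circle x))"

lemma C1_liftD:
  assumes "C1_lift f F F'"
  shows "pos_C1_on UNIV F F'" "F (x + 1) = F x + 1" "to_circle (F x) = f (to_circle x)"
    "circle_lift f F" "(F has_real_derivative F' x) (at x)" "0 < F' x"
    "x < y \<Longrightarrow> F x < F y"
  using assms pos_C1_on_continuous[of UNIV F F'] pos_C1_on_less[of UNIV F F' x y]
  by (auto simp: C1_lift_def circle_lift_def pos_C1_on_def)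

lemma C1_lift_circle_deriv:
  assumes "C1_lift f F F'"
  shows "circle_deriv f (to_circle x) = F' x"
  by (rule circle_deriv_lift[OF C1_liftD(4,5)[OF assms]])

text \<open>Degree one makes the values at consecutive integers differ by 1, so two of them bracket
  \<open>y\<close>.\<close>

lemma C1_lift_surj:
  assumes F: "C1_lift f F F'"
  obtains x where "F x = y"
proof -
  have int: "F (of_int k) = F 0 + of_int k" for k
    using degree_one_int[where F = F, OF C1_liftD(2)[OF F], of 0 k] by simp
  define k where "k = \<lfloor>y - F 0\<rfloor>"
  have "F (of_int k) \<le> y" "y \<le> F (of_int (k + 1))"
    unfolding int unfolding k_def by linarith+
  moreover have "continuous_on {of_int k..of_int (k + 1)} F"
    using pos_C1_on_continuous[OF C1_liftD(1)[OF F]] by (rule continuous_on_subset) simp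
  ultimately show ?thesis
    using IVT'[of F "of_int k" y "of_int (k + 1)"] that by auto
qed

lemma C1_lift_eq_iff: "C1_lift f F F' \<Longrightarrow> F x = F y \<longleftrightarrow> x = y"
  using C1_liftD(7) by (metis less_irrefl linorder_less_linear)

text \<open>Injectivity: if \<open>F x\<close> and \<open>F y\<close> differ by an integer
  \<open>k\<close>, then \<open>F x = F (y + k)\<close>, so \<open>x\<close> and
  \<open>y + k\<close> coincide and represent the same point as \<open>y\<close>.\<close>

lemma C1_lift_bij:
  assumes F: "C1_lift f F F'"
  shows "bij f"
proof (rule bijI)
  show "inj f"
  proof (rule injI)
    fix z w assume fzw: "f z = f w"
    obtain x y where xy: "z = to_circle x" "w = to_circle y" by (metis to_circle_cases)
    then have "to_circle (F x) = to_circle (F y)" using fzw C1_liftD(3)[OF F] by simp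
    then obtain k where "F x - F y = of_int k" by (auto simp: to_circle_eq_iff elim: Ints_cases)
    then have "F x = F (y + of_int k)"
      using degree_one_int[where F = F, OF C1_liftD(2)[OF F], of y k] by simp
    then show "z = w" using xy C1_lift_eq_iff[OF F] by (simp add: to_circle_eq_iff)
  qed
  have "\<exists>w. z = f w" for z
  proof -
    obtain y where "z = to_circle y" by (metis to_circle_cases)
    moreover obtain x where "F x = y" using C1_lift_surj[OF F] .
    ultimately show ?thesis using C1_liftD(3)[OF F, of x] by auto
  qed
  then show "surj f" unfolding surj_def by blast
qed

text \<open>Bijectivity of \<open>f\<close> is traded for the equation
  \<open>F (x + 1) = F x + 1\<close>: monotonicity makes the degree positive and injectivity
  excludes larger degrees.\<close>

lemma circle_C1_diffeo_iff: "circle_C1_diffeo f \<longleftrightarrow> (\<exists>F F'. C1_lift f F F')"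
proof
  assume "\<exists>F F'. C1_lift f F F'"
  then obtain F F' where F: "C1_lift f F F'" by blast
  then have "deriv F = F'" using C1_liftD(5) DERIV_imp_deriv by blast
  then show "circle_C1_diffeo f"
    using C1_lift_bij[OF F] C1_liftD[OF F] unfolding circle_C1_diffeo_def
    by (auto simp: pos_C1_on_def real_differentiable_def intro!: exI[of _ F])
next
  assume "circle_C1_diffeo f"
  then obtain F where "bij f" and lift: "circle_lift f F"
    and d: "\<And>x. F differentiable (at x) \<and> deriv F x > 0" "continuous_on UNIV (deriv F)"
    unfolding circle_C1_diffeo_def by blast
  have "(F has_real_derivative deriv F x) (at x)" for x
    using d(1)[of x] by (metis DERIV_imp_deriv real_differentiable_def)
  then have C1: "pos_C1_on UNIV F (deriv F)" using d by (simp add: pos_C1_on_def)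
  have lift': "to_circle (F x) = f (to_circle x)" for x using lift by (simp add: circle_lift_def)
  have "F (x + 1) = F x + 1" for x
  proof -
    have "to_circle (F (x + 1)) = to_circle (F x)" by (simp add: lift')
    then obtain k where k: "F (x + 1) - F x = of_int k"
      by (auto simp: to_circle_eq_iff elim: Ints_cases)
    have "F x < F (x + 1)" by (rule pos_C1_on_less[OF C1]) auto
    then have "0 < real_of_int k" using k by linarith
    then have "0 < k" by simp
    moreover have "\<not> 1 < k"
    proof
      \<comment> \<open>A lift of degree at least 2 takes the value \<open>F x + 1\<close> strictly between \<open>x\<close> and \<open>x + 1\<close>.\<close>
      assume "1 < k"
      then have lt: "F x + 1 < F (x + 1)" using k by linarith
      have "continuous_on {x..x + 1} F"
        using pos_C1_on_continuous[OF C1] by (rule continuous_on_subset) simp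
      then obtain y where y: "x \<le> y" "y \<le> x + 1" "F y = F x + 1"
        using IVT'[of F x "F x + 1" "x + 1"] lt by auto
      then have "f (to_circle y) = f (to_circle x)" by (simp flip: lift')
      then have "to_circle y = to_circle x" using \<open>bij f\<close> by (simp add: bij_def inj_eq)
      then obtain j where j: "y - x = of_int j"
        by (auto simp: to_circle_eq_iff elim: Ints_cases)
      have "y \<noteq> x" "y \<noteq> x + 1" using y lt by auto
      then have "0 < real_of_int j" "real_of_int j < 1" using j y by linarith+
      then show False by simp
    qed
    ultimately show ?thesis using k by simp
  qed
  then have "C1_lift f F (deriv F)" using C1 lift' by (simp add: C1_lift_def)
  then show "\<exists>F F'. C1_lift f F F'" by blast
qed

text \<open>Degree one makes the class of \<open>F x\<close> independent of the chosen
  representative. This is how conjugacies and rotations of the circle are built.\<close>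

lemma ex_C1_lift_circle_map:
  assumes F: "pos_C1_on UNIV F F'" "\<And>x. F (x + 1) = F x + 1"
  shows "\<exists>f. C1_lift f F F'"
proof -
  define f where "f z = to_circle (F (SOME x. to_circle x = z))" for z
  have "to_circle (F x) = f (to_circle x)" for x
  proof -
    define y where "y = (SOME y. to_circle y = to_circle x)"
    have "to_circle y = to_circle x" unfolding y_def by (rule someI) (rule refl)
    then obtain k where "x - y = of_int k"
      by (metis Ints_cases to_circle_eq_iff)
    then have "F x = F y + of_int k"
      using degree_one_int[where F = F, OF F(2), of y k] by (simp add: algebra_simps)
    then have "to_circle (F x) = to_circle (F y)" by (simp add: to_circle_eq_iff)
    then show ?thesis unfolding f_def y_def .
  qed
  then show ?thesis using F by (auto simp: C1_lift_def)
qed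

lemma C1_lift_id: "C1_lift id (\<lambda>x. x) (\<lambda>_. 1)"
  by (auto simp: C1_lift_def pos_C1_on_def)

lemma C1_lift_comp:
  assumes F: "C1_lift f F F'" and G: "C1_lift g G G'"
  shows "C1_lift (f \<circ> g) (F \<circ> G) (\<lambda>x. F' (G x) * G' x)"
  unfolding C1_lift_def
  using pos_C1_on_comp[OF C1_liftD(1)[OF F] C1_liftD(1)[OF G]] C1_liftD(2,3)[OF F] C1_liftD(2,3)[OF G]
  by simp

lemma C1_lift_inverse:
  assumes F: "C1_lift f F F'"
  obtains G where "C1_lift (inv f) G (\<lambda>y. 1 / F' (G y))"
proof -
  have "\<exists>x. F x = y" for y using C1_lift_surj[OF F] by blast
  then obtain G where FG: "\<And>y. F (G y) = y" by metis
  then have GF: "G (F x) = x" for x using C1_lift_eq_iff[OF F] by blast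
  have "isCont G y" for y
  proof -
    \<comment> \<open>The inverse function rule yields continuity at points of the form
      \<open>F x\<close>; every \<open>y\<close> has this form, namely
      \<open>F (G y)\<close>.\<close>
    have "isCont G (F (G y))"
      by (rule isCont_inverse_function[OF zero_less_one])
        (use pos_C1_on_continuous[OF C1_liftD(1)[OF F]] GF in
          \<open>auto simp: continuous_on_eq_continuous_at\<close>)
    then show ?thesis by (simp add: FG)
  qed
  then have "pos_C1_on UNIV G (\<lambda>y. 1 / F' (G y))"
    by (intro pos_C1_on_inverse[OF C1_liftD(1)[OF F]] FG)
      (auto simp: continuous_on_eq_continuous_at)
  moreover have "G (y + 1) = G y + 1" for y
    using C1_liftD(2)[OF F, of "G y"] by (metis FG GF)
  moreover have "to_circle (G y) = inv f (to_circle y)" for y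
    using C1_liftD(3)[OF F, of "G y"] FG C1_lift_bij[OF F] by (metis bij_inv_eq_iff)
  ultimately show ?thesis by (intro that[of G]) (simp add: C1_lift_def)
qed

section \<open>Variation and log-derivatives on the circle\<close>

text \<open>The lift maps \<open>[0, 1]\<close> monotonically to the period starting at
  \<open>F 0\<close>, and periodicity of the pulled-back function brings it back to
  \<open>[0, 1]\<close>.\<close>

lemma circle_total_variation_comp:
  assumes F: "C1_lift f F F'" and bv: "circle_bounded_variation \<phi>"
  shows "circle_bounded_variation (\<lambda>z. \<phi> (f z)) \<and>
    circle_total_variation (\<lambda>z. \<phi> (f z)) \<le> circle_total_variation \<phi>"
proof -
  have per: "bounded_variation (F 0) (F 0 + 1) (\<phi> \<circ> to_circle) \<and>
      total_variation (F 0) (F 0 + 1) (\<phi> \<circ> to_circle) \<le> total_variation 0 1 (\<phi> \<circ> to_circle)"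
    using bv by (intro total_variation_periodic) (auto simp: circle_bounded_variation_def)
  have "mono_on {0..1} F" by (rule pos_C1_on_mono[OF C1_liftD(1)[OF F]]) simp
  moreover from mono_onD[OF this, of 0] mono_onD[OF this, of _ 1]
  have "F ` {0..1} \<subseteq> {F 0..F 0 + 1}"
    using C1_liftD(2)[OF F, of 0] by auto
  ultimately have "bounded_variation 0 1 ((\<lambda>z. \<phi> (f z)) \<circ> to_circle) \<and>
      total_variation 0 1 ((\<lambda>z. \<phi> (f z)) \<circ> to_circle)
        \<le> total_variation (F 0) (F 0 + 1) (\<phi> \<circ> to_circle)"
    using per C1_liftD(3)[OF F] by (intro total_variation_comp) auto
  then show ?thesis
    using per unfolding circle_bounded_variation_def circle_total_variation_def by linarith
qed

lemma C1_lift_continuous_ln_deriv: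
  assumes "C1_lift f F F'"
  shows "continuous_on UNIV ((\<lambda>z. ln (circle_deriv f z)) \<circ> to_circle)"
  using pos_C1_on_continuous_ln[OF C1_liftD(1)[OF assms]]
  by (simp add: o_def C1_lift_circle_deriv[OF assms])

lemma ex_circle_diffeo_ln_deriv:
  assumes cont: "continuous_on UNIV (\<phi> \<circ> to_circle)"
  obtains h H H' c where "C1_lift h H H'" "\<And>z. ln (circle_deriv h z) = \<phi> z + c"
proof -
  define p where "p = \<phi> \<circ> to_circle"
  \<comment> \<open>An antiderivative on the whole line, so that \<open>W (x + 1)\<close> and
    \<open>W x\<close> can be compared for every real \<open>x\<close>.\<close>
  obtain W where "\<And>x. (W has_vector_derivative exp (p x)) (at x)"
    using einterval_antiderivative[of "-\<infinity>" "\<infinity>" "\<lambda>x. exp (p x)"] cont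
    by (auto simp: p_def continuous_on_eq_continuous_at intro!: continuous_intros)
  then have W: "(W has_real_derivative exp (p x)) (at x)" for x
    by (simp add: has_real_derivative_iff_has_vector_derivative)
  have "pos_C1_on UNIV W (\<lambda>x. exp (p x))"
    using W cont by (auto simp: pos_C1_on_def p_def intro!: continuous_on_exp)
  then have pos: "W 0 < W 1" by (rule pos_C1_on_less) auto
  \<comment> \<open>\<open>K\<close> is the integral of \<open>exp (p x)\<close> over one period,
    the same for all periods. Dividing by it gives degree one and produces the additive constant
    \<open>- ln K\<close>.\<close>
  define K where "K = W 1 - W 0"
  have "((\<lambda>x. W (x + 1) - W x) has_real_derivative 0) (at x)" for x
  proof -
    have "((\<lambda>x. W (x + 1)) has_real_derivative exp (p (x + 1))) (at x)"
      using W[of "x + 1"] by (simp only: DERIV_shift)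
    from DERIV_diff[OF this W[of x]] show ?thesis by (simp add: p_def)
  qed
  then have "W (x + 1) - W x = W (0 + 1) - W 0" for x
    using DERIV_isconst_all[of "\<lambda>x. W (x + 1) - W x"] by blast
  then have K: "W (x + 1) = W x + K" for x
    unfolding K_def by (metis add.commute add_0 diff_add_cancel)
  have "0 < K" using pos by (simp add: K_def)
  have H: "pos_C1_on UNIV (\<lambda>x. W x / K) (\<lambda>x. exp (p x) / K)"
    using W cont \<open>0 < K\<close> unfolding pos_C1_on_def p_def
    by (auto intro!: DERIV_cdivide continuous_on_divide continuous_on_exp continuous_on_const)
  obtain h where h: "C1_lift h (\<lambda>x. W x / K) (\<lambda>x. exp (p x) / K)"
    using ex_C1_lift_circle_map[OF H] K \<open>0 < K\<close> by (auto simp: add_divide_distrib)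
  have "ln (circle_deriv h z) = \<phi> z + - ln K" for z
  proof -
    obtain x where "z = to_circle x" by (metis to_circle_cases)
    then show ?thesis
      using C1_lift_circle_deriv[OF h, of x] \<open>0 < K\<close> by (simp add: p_def ln_div)
  qed
  then show ?thesis by (rule that[OF h])
qed

text \<open>Continuity is required of the pullback along \<open>to_circle\<close>, the form in which
  lifts deliver it and in which it can be integrated.\<close>

lemma circle_log_derivative_cocycle:
  "log_derivative_cocycle UNIV (Collect circle_C1bv_diffeo) (\<lambda>f z. ln (circle_deriv f z))
    (\<lambda>\<phi>. continuous_on UNIV (\<phi> \<circ> to_circle) \<and> circle_bounded_variation \<phi>) circle_total_variation"
proof -
  note defs = circle_bounded_variation_def circle_total_variation_def
  have chain: "ln (circle_deriv (f \<circ> g) z) = ln (circle_deriv f (g z)) + ln (circle_deriv g z)"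
    if F: "C1_lift f F F'" and G: "C1_lift g G G'" for f F F' g G G' z
  proof -
    obtain x where z: "z = to_circle x" by (metis to_circle_cases)
    have "circle_deriv f (g z) = F' (G x)"
      using C1_lift_circle_deriv[OF F, of "G x"] C1_liftD(3)[OF G, of x] z by simp
    then show ?thesis
      using C1_lift_circle_deriv[OF C1_lift_comp[OF F G], of x] C1_lift_circle_deriv[OF G, of x] z
        C1_liftD(6)[OF F, of "G x"] C1_liftD(6)[OF G, of x] by (simp add: ln_mult_pos)
  qed
  have inv: "ln (circle_deriv (inv f) z) = - ln (circle_deriv f (inv f z))"
    if F: "C1_lift f F F'" for f F F' z
  proof -
    obtain G where G: "C1_lift (inv f) G (\<lambda>y. 1 / F' (G y))" using C1_lift_inverse[OF F] .
    obtain x where z: "z = to_circle x" by (metis to_circle_cases)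
    have "circle_deriv f (inv f z) = F' (G x)"
      using C1_lift_circle_deriv[OF F, of "G x"] C1_liftD(3)[OF G, of x] z by simp
    then show ?thesis
      using C1_lift_circle_deriv[OF G, of x] z C1_liftD(6)[OF F, of "G x"] by (simp add: ln_div)
  qed
  have add: "circle_bounded_variation (\<lambda>z. \<phi> z + \<psi> z) \<and>
      circle_total_variation (\<lambda>z. \<phi> z + \<psi> z) \<le> circle_total_variation \<phi> + circle_total_variation \<psi>"
    if "circle_bounded_variation \<phi>" "circle_bounded_variation \<psi>" for \<phi> \<psi>
    using total_variation_add[of 0 1 "\<phi> \<circ> to_circle" "\<psi> \<circ> to_circle"] that by (simp add: defs o_def)
  have scale: "circle_bounded_variation (\<lambda>z. c * \<phi> z) \<and>
      circle_total_variation (\<lambda>z. c * \<phi> z) \<le> \<bar>c\<bar> * circle_total_variation \<phi>"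
    if "circle_bounded_variation \<phi>" for \<phi> c
    using total_variation_scale[of 0 1 "\<phi> \<circ> to_circle" c] that by (simp add: defs o_def)
  have const: "circle_bounded_variation (\<lambda>z. c) \<and> circle_total_variation (\<lambda>z. c) = 0" for c
    using total_variation_const[of 0 1 c] by (simp add: defs o_def)
  show ?thesis
  proof
    fix f g assume "f \<in> Collect circle_C1bv_diffeo" "g \<in> Collect circle_C1bv_diffeo"
    then obtain F F' G G' where F: "C1_lift f F F'" and G: "C1_lift g G G'"
      and bv: "circle_bounded_variation (\<lambda>z. ln (circle_deriv f z))"
        "circle_bounded_variation (\<lambda>z. ln (circle_deriv g z))"
      by (auto simp: circle_C1bv_diffeo_def circle_C1_diffeo_iff)
    obtain J where J: "C1_lift (inv f) J (\<lambda>y. 1 / F' (J y))" using C1_lift_inverse[OF F] .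
    show "bij_betw f UNIV UNIV" by (rule C1_lift_bij[OF F])
    show "continuous_on UNIV ((\<lambda>z. ln (circle_deriv f z)) \<circ> to_circle) \<and>
        circle_bounded_variation (\<lambda>z. ln (circle_deriv f z))"
      using C1_lift_continuous_ln_deriv[OF F] bv(1) by simp
    show "ln (circle_deriv (f \<circ> g) z) = ln (circle_deriv f (g z)) + ln (circle_deriv g z)" for z
      by (rule chain[OF F G])
    show "ln (circle_deriv (inv f) z) = - ln (circle_deriv f (inv f z))" for z
      by (rule inv[OF F])
    have "circle_bounded_variation (\<lambda>z. ln (circle_deriv (f \<circ> g) z))"
      unfolding chain[OF F G]
      by (intro conjunct1[OF add] conjunct1[OF circle_total_variation_comp[OF G]] bv)
    then show "f \<circ> g \<in> Collect circle_C1bv_diffeo"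
      using C1_lift_comp[OF F G] by (auto simp: circle_C1bv_diffeo_def circle_C1_diffeo_iff)
    have "circle_bounded_variation (\<lambda>z. - 1 * ln (circle_deriv f (inv f z)))"
      by (intro conjunct1[OF scale] conjunct1[OF circle_total_variation_comp[OF J]] bv)
    then show "inv f \<in> Collect circle_C1bv_diffeo"
      using J by (auto simp: circle_C1bv_diffeo_def circle_C1_diffeo_iff inv[OF F])
    fix \<phi> :: "circle \<Rightarrow> real"
    assume \<phi>: "continuous_on UNIV (\<phi> \<circ> to_circle) \<and> circle_bounded_variation \<phi>"
    have "(\<lambda>z. \<phi> (f z)) \<circ> to_circle = (\<phi> \<circ> to_circle) \<circ> F"
      using C1_liftD(3)[OF F] by (simp add: fun_eq_iff)
    moreover have "continuous_on UNIV ((\<phi> \<circ> to_circle) \<circ> F)"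
      by (rule continuous_on_compose[OF pos_C1_on_continuous[OF C1_liftD(1)[OF F]]])
        (rule continuous_on_subset[OF conjunct1[OF \<phi>] subset_UNIV])
    ultimately show "(continuous_on UNIV ((\<lambda>z. \<phi> (f z)) \<circ> to_circle) \<and>
        circle_bounded_variation (\<lambda>z. \<phi> (f z))) \<and>
        circle_total_variation (\<lambda>z. \<phi> (f z)) \<le> circle_total_variation \<phi>"
      using circle_total_variation_comp[OF F, of \<phi>] \<phi> by simp
  next
    have "circle_deriv id z = 1" for z
      using C1_lift_circle_deriv[OF C1_lift_id] to_circle_cases[of z] by metis
    then show "id \<in> Collect circle_C1bv_diffeo"
      using C1_lift_id const[of 0] by (auto simp: circle_C1bv_diffeo_def circle_C1_diffeo_iff)
  next
    fix \<phi> \<psi> :: "circle \<Rightarrow> real"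
    assume \<phi>: "continuous_on UNIV (\<phi> \<circ> to_circle) \<and> circle_bounded_variation \<phi>"
    show "(continuous_on UNIV (\<psi> \<circ> to_circle) \<and> circle_bounded_variation \<psi>) \<and>
        circle_total_variation \<psi> = circle_total_variation \<phi>"
      if "\<And>z. z \<in> UNIV \<Longrightarrow> \<psi> z = \<phi> z"
    proof -
      have "\<psi> = \<phi>" using that by auto
      then show ?thesis using \<phi> by simp
    qed
    show "0 \<le> circle_total_variation \<phi>"
      using \<phi> total_variation_nonneg[of 0 1] by (simp add: defs)
    show "continuous_on UNIV (\<psi> \<circ> to_circle) \<and> circle_bounded_variation \<psi> \<Longrightarrow>
        (continuous_on UNIV ((\<lambda>z. \<phi> z + \<psi> z) \<circ> to_circle) \<and>
          circle_bounded_variation (\<lambda>z. \<phi> z + \<psi> z)) \<and>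
        circle_total_variation (\<lambda>z. \<phi> z + \<psi> z) \<le> circle_total_variation \<phi> + circle_total_variation \<psi>"
      using add[of \<phi> \<psi>] \<phi> by (auto simp: o_def intro: continuous_on_add)
    show "(continuous_on UNIV ((\<lambda>z. c * \<phi> z) \<circ> to_circle) \<and>
          circle_bounded_variation (\<lambda>z. c * \<phi> z)) \<and>
        circle_total_variation (\<lambda>z. c * \<phi> z) \<le> \<bar>c\<bar> * circle_total_variation \<phi>" for c
      using scale[of \<phi> c] \<phi> by (auto simp: o_def intro: continuous_on_mult_left)
    obtain h H H' c where h: "C1_lift h H H'" "\<And>z. ln (circle_deriv h z) = \<phi> z + c"
      using ex_circle_diffeo_ln_deriv[OF conjunct1[OF \<phi>]] by metis
    have "circle_bounded_variation (\<lambda>z. ln (circle_deriv h z))"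
      unfolding h(2) using \<phi> const by (intro conjunct1[OF add]) auto
    then have "h \<in> Collect circle_C1bv_diffeo"
      using h(1) by (auto simp: circle_C1bv_diffeo_def circle_C1_diffeo_iff)
    then show "\<exists>h\<in>Collect circle_C1bv_diffeo. \<exists>c. \<forall>z\<in>UNIV. ln (circle_deriv h z) = \<phi> z + c"
      using h(2) by blast
  qed (use const in \<open>auto simp: o_def\<close>)
qed

text \<open>By degree one the lift gains exactly 1 over \<open>[0, 1]\<close>, so its derivative is
  1 somewhere there.\<close>

lemma circle_ln_deriv_le_variation:
  assumes "circle_C1bv_diffeo f"
  shows "\<bar>ln (circle_deriv f z)\<bar> \<le> circle_total_variation (\<lambda>z. ln (circle_deriv f z))"
proof -
  have bv: "bounded_variation 0 1 ((\<lambda>z. ln (circle_deriv f z)) \<circ> to_circle)"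
    using assms by (simp add: circle_C1bv_diffeo_def circle_bounded_variation_def)
  obtain F F' where F: "C1_lift f F F'"
    using assms by (auto simp: circle_C1bv_diffeo_def circle_C1_diffeo_iff)
  obtain y where y: "y \<in> {0<..<1}" "F 1 - F 0 = F' y * (1 - 0)"
    using pos_C1_on_mvt[OF C1_liftD(1)[OF F], of 0 1] by auto
  then have "F' y = 1" using C1_liftD(2)[OF F, of 0] by simp
  obtain x where "0 \<le> x" "x \<le> 1" "z = to_circle x" by (rule to_circle_cases)
  then show ?thesis
    using diff_le_total_variation[OF bv, of x y] y(1) \<open>F' y = 1\<close> C1_lift_circle_deriv[OF F, of y]
    by (simp add: circle_total_variation_def)
qed

text \<open>A translation of the line has degree one, and it preserves differences of
  representatives, hence circle distances.\<close>

lemma circle_rotation: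
  obtains R where "C1_lift R (\<lambda>x. x + \<theta>) (\<lambda>_. 1)" "circle_isometry R"
proof -
  have "pos_C1_on UNIV (\<lambda>x. x + \<theta>) (\<lambda>_. 1)"
    by (auto simp: pos_C1_on_def intro!: derivative_eq_intros)
  then obtain R where R: "C1_lift R (\<lambda>x. x + \<theta>) (\<lambda>_. 1)"
    using ex_C1_lift_circle_map[of "\<lambda>x. x + \<theta>"] by auto
  have "dist (R z) (R w) = dist z w" for z w
  proof -
    obtain x y where "z = to_circle x" "w = to_circle y" by (metis to_circle_cases)
    then show ?thesis
      using C1_liftD(3)[OF R, of x, symmetric] C1_liftD(3)[OF R, of y, symmetric]
      by (simp add: dist_to_circle)
  qed
  then show ?thesis
    using that[OF R] R unfolding circle_isometry_def circle_C1_diffeo_iff by blast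
qed

text \<open>No common fixed point is available on the circle: small variation makes the maps nearly
  rotations but leaves their angles free to oscillate. Compactness of the possible angles selects a
  limit \<open>\<theta>\<close>.\<close>

lemma circle_converges_subseq:
  assumes g: "\<And>n. circle_C1bv_diffeo (g n)"
    and lim: "(\<lambda>n. circle_total_variation (\<lambda>z. ln (circle_deriv (g n) z))) \<longlonglongrightarrow> 0"
  obtains r R where "strict_mono (r :: nat \<Rightarrow> nat)" "circle_isometry R"
    "circle_C1bv_converges (\<lambda>n. g (r n)) R"
proof -
  have "\<exists>G G'. C1_lift (g n) G G' \<and> G 0 \<in> {0..1}" for n
  proof -
    obtain G G' where G: "C1_lift (g n) G G'"
      using g[of n] by (auto simp: circle_C1bv_diffeo_def circle_C1_diffeo_iff)
    \<comment> \<open>Subtracting an integer changes neither the circle map nor the derivative, and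
      it brings the value at 0 into a compact set.\<close>
    define k where "k = \<lfloor>G 0\<rfloor>"
    have "to_circle (G x - of_int k) = to_circle (G x)" for x
      by (simp add: to_circle_eq_iff)
    then have "C1_lift (g n) (\<lambda>x. G x - of_int k) G'"
      using G by (auto simp: C1_lift_def pos_C1_on_def intro!: derivative_eq_intros)
    moreover have "G 0 - of_int k \<in> {0..1}" unfolding k_def by (simp; linarith)
    ultimately show ?thesis by (intro exI[of _ "\<lambda>x. G x - of_int k"] exI[of _ G']) simp
  qed
  then obtain G G' where G: "\<And>n. C1_lift (g n) (G n) (G' n)" and G0: "\<And>n. G n 0 \<in> {0..1}"
    by metis
  obtain \<theta> r where r: "strict_mono (r :: nat \<Rightarrow> nat)" and \<theta>: "((\<lambda>n. G n 0) \<circ> r) \<longlonglongrightarrow> \<theta>"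
    using compact_Icc[of "0::real" 1] G0 unfolding compact_def by metis
  define v where "v n = circle_total_variation (\<lambda>z. ln (circle_deriv (g (r n)) z))" for n
  have v: "v \<longlonglongrightarrow> 0"
    using LIMSEQ_subseq_LIMSEQ[OF lim r] unfolding v_def o_def .
  have "(\<lambda>n. exp (v n) - 1) \<longlonglongrightarrow> exp 0 - 1" by (intro tendsto_intros v)
  then have v0: "(\<lambda>n. exp (v n) - 1) \<longlonglongrightarrow> 0" by simp
  have "\<bar>ln (G' (r n) x)\<bar> \<le> v n" for n x
    using circle_ln_deriv_le_variation[OF g, of "r n" "to_circle x"] C1_lift_circle_deriv[OF G]
    by (simp add: v_def)
  then have near: "\<bar>G' (r n) x - 1\<bar> \<le> exp (v n) - 1"
      "\<bar>(G (r n) x - x) - (G (r n) y - y)\<bar> \<le> (exp (v n) - 1) * \<bar>x - y\<bar>" for n x y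
    using pos_C1_on_near_isometry[OF C1_liftD(1)[OF G], where v = "v n"] by simp_all
  obtain R where R: "C1_lift R (\<lambda>x. x + \<theta>) (\<lambda>_. 1)" "circle_isometry R"
    by (rule circle_rotation)
  have "dist (g (r n) z) (R z) \<le> (exp (v n) - 1) + \<bar>G (r n) 0 - \<theta>\<bar>" for n z
  proof -
    obtain x where x: "0 \<le> x" "x \<le> 1" "z = to_circle x" by (rule to_circle_cases)
    have "dist (g (r n) z) (R z) = dist_to_int (G (r n) x - (x + \<theta>))"
      using C1_liftD(3)[OF G, of "r n" x] C1_liftD(3)[OF R(1), of x] x(3)
      by (metis dist_to_circle)
    also have "\<dots> \<le> \<bar>G (r n) x - (x + \<theta>)\<bar>"
      using dist_to_int_le[of _ 0] by simp
    \<comment> \<open>The point 0 takes over the role of the fixed endpoint; its own image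
      contributes the second term.\<close>
    also have "\<dots> \<le> \<bar>(G (r n) x - x) - (G (r n) 0 - 0)\<bar> + \<bar>G (r n) 0 - \<theta>\<bar>" by linarith
    also have "\<bar>(G (r n) x - x) - (G (r n) 0 - 0)\<bar> \<le> (exp (v n) - 1) * \<bar>x - 0\<bar>" by (rule near(2))
    also have "\<dots> \<le> (exp (v n) - 1) * 1"
      using x(1,2) order_trans[OF abs_ge_zero near(1)[of n 0]] by (intro mult_left_mono) auto
    finally show ?thesis by simp
  qed
  moreover have "(\<lambda>n. (exp (v n) - 1) + \<bar>G (r n) 0 - \<theta>\<bar>) \<longlonglongrightarrow> 0"
    using tendsto_add[OF v0 tendsto_rabs_zero[OF LIM_zero[OF \<theta>]]] by (simp add: o_def)
  ultimately have "uniform_limit UNIV (\<lambda>n. g (r n)) R sequentially"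
    by (rule uniform_limitI_bound)
  moreover have "uniform_limit UNIV (\<lambda>n. circle_deriv (g (r n))) (\<lambda>_. 1) sequentially"
  proof (rule uniform_limitI_bound[OF _ v0])
    fix n z
    obtain x where "z = to_circle x" by (metis to_circle_cases)
    then show "dist (circle_deriv (g (r n)) z) 1 \<le> exp (v n) - 1"
      using near(1)[of n x] C1_lift_circle_deriv[OF G] by (simp add: dist_real_def)
  qed
  ultimately show ?thesis
    using that[OF r R(2)] v unfolding circle_C1bv_converges_def v_def by blast
qed

theorem circle_distortion_zero_iff:
  assumes f: "circle_C1bv_diffeo f"
  shows "circle_asymptotic_distortion f = 0 \<longleftrightarrow>
    (\<exists>h. (\<forall>n. circle_C1bv_diffeo (h n)) \<and>
      (\<exists>R. circle_isometry R \<and> circle_C1bv_converges (\<lambda>n. h n \<circ> f \<circ> inv (h n)) R))"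
proof -
  interpret log_derivative_cocycle UNIV "Collect circle_C1bv_diffeo" "\<lambda>f z. ln (circle_deriv f z)"
    "\<lambda>\<phi>. continuous_on UNIV (\<phi> \<circ> to_circle) \<and> circle_bounded_variation \<phi>" circle_total_variation
    by (rule circle_log_derivative_cocycle)
  have iff: "circle_asymptotic_distortion f = 0 \<longleftrightarrow> (\<exists>h. (\<forall>n. circle_C1bv_diffeo (h n)) \<and>
      (\<lambda>n. circle_total_variation (\<lambda>z. ln (circle_deriv (h n \<circ> f \<circ> inv (h n)) z))) \<longlonglongrightarrow> 0)"
    using distortion_zero_iff[of f] f unfolding circle_asymptotic_distortion_def by simp
  show ?thesis
  proof
    assume "circle_asymptotic_distortion f = 0"
    then obtain h where h: "\<And>n. circle_C1bv_diffeo (h n)"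
      and lim: "(\<lambda>n. circle_total_variation (\<lambda>z. ln (circle_deriv (h n \<circ> f \<circ> inv (h n)) z))) \<longlonglongrightarrow> 0"
      unfolding iff by blast
    have "circle_C1bv_diffeo (h n \<circ> f \<circ> inv (h n))" for n using conj_in[of f "h n"] f h by simp
    \<comment> \<open>Passing to a subsequence is harmless: the conjugacies are re-indexed by
      \<open>r\<close>, and any sequence of them will do.\<close>
    from circle_converges_subseq[OF this lim] obtain r R where "circle_isometry R"
      "circle_C1bv_converges (\<lambda>n. h (r n) \<circ> f \<circ> inv (h (r n))) R" .
    then show "\<exists>h. (\<forall>n. circle_C1bv_diffeo (h n)) \<and>
        (\<exists>R. circle_isometry R \<and> circle_C1bv_converges (\<lambda>n. h n \<circ> f \<circ> inv (h n)) R)"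
      using h by (intro exI[of _ "\<lambda>n. h (r n)"]) blast
  qed (auto simp: iff circle_C1bv_converges_def)
qed

theorem theorem3:
  shows "(\<forall>a b f. a < b \<longrightarrow> ivl_C1bv_diffeo a b f \<longrightarrow>
            (ivl_asymptotic_distortion a b f = 0 \<longleftrightarrow>
             (\<exists>h. (\<forall>n. ivl_C1bv_diffeo a b (h n)) \<and>
                  (\<exists>R. ivl_isometry a b R \<and>
                       ivl_C1bv_converges a b
                         (\<lambda>n. h n \<circ> f \<circ> inv_into {a..b} (h n)) R)))) \<and>
         (\<forall>f. circle_C1bv_diffeo f \<longrightarrow>
            (circle_asymptotic_distortion f = 0 \<longleftrightarrow>
             (\<exists>h. (\<forall>n. circle_C1bv_diffeo (h n)) \<and>
                  (\<exists>R. circle_isometry R \<and>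
                       circle_C1bv_converges (\<lambda>n. h n \<circ> f \<circ> inv (h n)) R))))"
  using ivl_distortion_zero_iff circle_distortion_zero_iff by blast

end
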